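(* Let $K$ be a field, let $n\geq 2$ be an integer, let $\mathbf{q}=(q_{ij})_{1\leq i<j\leq n}$ be a family of non-zero scalars in $K$, and let $A(\mathbf{q})=K_{\mathbf{q}}[X_1,\ldots,X_n]/(X_1^2,\ldots,X_n^2)$, where $K_{\mathbf{q}}[X_1,\ldots,X_n]$ is the quantum polynomial algebra. Then: (i) $A(\mathbf{q})$ is a Frobenius algebra, and it is a symmetric algebra if and only if $$q_{in}=\left(\prod_{1\leq p<i}q_{pi}\right)\cdot\left(\prod_{i<p\leq n-1}q_{ip}^{-1}\right)$$ for any $1\leq i\leq n-1$. (ii) Regarded with the $\mathbb{Z}_2^n$-grading, $A(\mathbf{q})$ is $(\hat{1},\ldots,\hat{1})$-graded Frobenius, but it is not $\sigma$-graded Frobenius for any $\sigma\in\mathbb{Z}_2^n$ with $\sigma\neq(\hat{1},\ldots,\hat{1})$. (iii) Regarded with the $\mathbb{Z}$-grading, $A(\mathbf{q})$ is $n$-graded Frobenius, but it is not $j$-graded Frobenius for any $j\in\mathbb{Z}$ with $j\neq n$.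
   Context: The quantum polynomial algebra $K_{\mathbf{q}}[X_1,\ldots,X_n]$ is the quotient of the free associative unital $K$-algebra $K\langle X_1,\ldots,X_n\rangle$ by the ideal generated by all $X_jX_i-q_{ij}X_iX_j$ with $1\leq i<j\leq n$. The algebra $A(\mathbf{q})$ is its quotient by the two-sided ideal generated by the images of $X_1^2,\ldots,X_n^2$. Let $x_1,\ldots,x_n$ be the classes of $X_1,\ldots,X_n$ in $A(\mathbf{q})$. A $K$-basis of $A(\mathbf{q})$ consists of all $x_1^{\varepsilon_1}\cdots x_n^{\varepsilon_n}$ with $\varepsilon_1,\ldots,\varepsilon_n\in\{0,1\}$. The $\mathbb{Z}$-grading: the homogeneous component of degree $d\in\mathbb{Z}$ is the span of all $x_1^{\varepsilon_1}\cdots x_n^{\varepsilon_n}$ with $\varepsilon_1,\ldots,\varepsilon_n\in\{0,1\}$ and $\varepsilon_1+\cdots+\varepsilon_n=d$. The $\mathbb{Z}_2^n$-grading, where $\mathbb{Z}_2=\{\hat 0,\hat 1\}$ is the group with two elements: the homogeneous component of degree $(\widehat{\varepsilon_1},\ldots,\widehat{\varepsilon_n})$ is $Kx_1^{\varepsilon_1}\cdots x_n^{\varepsilon_n}$ for $\varepsilon_1,\ldots,\varepsilon_n\in\{0,1\}$. For a finite-dimensional $K$-algebra $A$, the linear dual $A^*$ is an $A$-bimodule by $(r\rightharpoonup a^* )(a)=a^*(ar)$ and $(a^*\leftharpoonup r)(a)=a^*(ra)$ for $r,a\in A$, $a^*\in A^*$. $A$ is Frobenius if $A\simeq A^*$ as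 left $A$-modules, and symmetric if $A\simeq A^*$ as $A$-bimodules. If $A=\bigoplus_{g\in G}A_g$ is graded by a group $G$ (written multiplicatively) and $\sigma\in G$, then $A^*$ is a graded left $A$-module with $(A^* )_g=\{a^*\in A^*\mid a^*(A_h)=0\text{ for any }h\neq g^{-1}\}$, and the shift $A(\sigma)$ is the left $A$-module $A$ with grading $A(\sigma)_g=A_{g\sigma}$. $A$ is called $\sigma$-graded Frobenius if $A^*\simeq A(\sigma)$ as graded left $A$-modules, i.e. via an $A$-linear isomorphism preserving degrees. (For $G=\mathbb{Z}$ or $\mathbb{Z}_2^n$ the group operation is addition.) Empty products equal $1$. *)

theory Defs
  imports "HOL-Algebra.Algebra" "HOL-Library.Poly_Mapping"
begin

section \<open>Finite-dimensional algebras over a field\<close>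

text \<open>
  Neither the locale \<open>module\<close> nor \<open>algebra\<close> of HOL-Algebra can serve here: the latter requires the
  algebra itself to be commutative, and both require a ring of scalars given by a record. Only the
  record type \<open>('k, 'a) module\<close> is reused; its scalars are a field \<open>'k\<close> given by the type class.
\<close>

locale k_algebra = ring A for A :: "('k::field, 'a) module" (structure) +
  assumes smult_closed: "x \<in> carrier A \<Longrightarrow> c \<odot> x \<in> carrier A"
    and smult_add_left: "x \<in> carrier A \<Longrightarrow> (c + d) \<odot> x = c \<odot> x \<oplus> d \<odot> x"
    and smult_add_right:
      "x \<in> carrier A \<Longrightarrow> y \<in> carrier A \<Longrightarrow> c \<odot> (x \<oplus> y) = c \<odot> x \<oplus> c \<odot> y"
    and smult_smult: "x \<in> carrier A \<Longrightarrow> (c * d) \<odot> x = c \<odot> (d \<odot> x)"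
    and smult_1: "x \<in> carrier A \<Longrightarrow> 1 \<odot> x = x"
    and smult_mult_left:
      "x \<in> carrier A \<Longrightarrow> y \<in> carrier A \<Longrightarrow> (c \<odot> x) \<otimes> y = c \<odot> (x \<otimes> y)"
    and smult_mult_right:
      "x \<in> carrier A \<Longrightarrow> y \<in> carrier A \<Longrightarrow> x \<otimes> (c \<odot> y) = c \<odot> (x \<otimes> y)"

definition k_span :: "('k::field, 'a) module \<Rightarrow> 'a set \<Rightarrow> 'a set" where
  "k_span A S = {(\<Oplus>\<^bsub>A\<^esub>b\<in>T. c b \<odot>\<^bsub>A\<^esub> b) | T c. finite T \<and> T \<subseteq> S}"

definition k_subspace :: "('k::field, 'a) module \<Rightarrow> 'a set \<Rightarrow> bool" where
  "k_subspace A V \<longleftrightarrow> V \<subseteq> carrier A \<and> \<zero>\<^bsub>A\<^esub> \<in> V \<and>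
     (\<forall>x\<in>V. \<forall>y\<in>V. x \<oplus>\<^bsub>A\<^esub> y \<in> V) \<and> (\<forall>c. \<forall>x\<in>V. c \<odot>\<^bsub>A\<^esub> x \<in> V)"

definition fin_dim_algebra :: "('k::field, 'a) module \<Rightarrow> bool" where
  "fin_dim_algebra A \<longleftrightarrow> k_algebra A \<and>
     (\<exists>B. finite B \<and> B \<subseteq> carrier A \<and> k_span A B = carrier A)"


section \<open>Frobenius and symmetric algebras\<close>

record ('r, 'm) bimodule = "'m partial_object" +
  madd :: "'m \<Rightarrow> 'm \<Rightarrow> 'm"
  lact :: "'r \<Rightarrow> 'm \<Rightarrow> 'm"
  ract :: "'m \<Rightarrow> 'r \<Rightarrow> 'm"

definition regular_bimodule :: "('k::field, 'a) module \<Rightarrow> ('a, 'a) bimodule" where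
  "regular_bimodule A =
     \<lparr>carrier = carrier A, madd = add A, lact = monoid.mult A, ract = monoid.mult A\<rparr>"

text \<open>Functionals are extensional, so that equality of functionals on \<open>A\<close> is equality in HOL.\<close>

definition dual_bimodule :: "('k::field, 'a) module \<Rightarrow> ('a, 'a \<Rightarrow> 'k) bimodule" where
  "dual_bimodule A =
     \<lparr>carrier = {f \<in> extensional (carrier A).
        (\<forall>x\<in>carrier A. \<forall>y\<in>carrier A. f (x \<oplus>\<^bsub>A\<^esub> y) = f x + f y) \<and>
        (\<forall>c. \<forall>x\<in>carrier A. f (c \<odot>\<^bsub>A\<^esub> x) = c * f x)},
      madd = (\<lambda>f g. \<lambda>a\<in>carrier A. f a + g a),
      lact = (\<lambda>r f. \<lambda>a\<in>carrier A. f (a \<otimes>\<^bsub>A\<^esub> r)),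
      ract = (\<lambda>f r. \<lambda>a\<in>carrier A. f (r \<otimes>\<^bsub>A\<^esub> a))\<rparr>"

text \<open>
  \<open>K\<close>-linearity of these isomorphisms is automatic, as \<open>c\<close> acts on both modules as \<open>c \<odot> \<one>\<close>.
\<close>

definition left_module_iso ::
    "('k::field, 'a) module \<Rightarrow> ('a, 'm) bimodule \<Rightarrow> ('a, 'n) bimodule \<Rightarrow> ('m \<Rightarrow> 'n) set" where
  "left_module_iso A M N = {\<phi>. bij_betw \<phi> (carrier M) (carrier N) \<and>
     (\<forall>x\<in>carrier M. \<forall>y\<in>carrier M. \<phi> (madd M x y) = madd N (\<phi> x) (\<phi> y)) \<and>
     (\<forall>r\<in>carrier A. \<forall>x\<in>carrier M. \<phi> (lact M r x) = lact N r (\<phi> x))}"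

definition bimodule_iso ::
    "('k::field, 'a) module \<Rightarrow> ('a, 'm) bimodule \<Rightarrow> ('a, 'n) bimodule \<Rightarrow> ('m \<Rightarrow> 'n) set" where
  "bimodule_iso A M N = {\<phi> \<in> left_module_iso A M N.
     \<forall>r\<in>carrier A. \<forall>x\<in>carrier M. \<phi> (ract M x r) = ract N (\<phi> x) r}"

definition frobenius_algebra :: "('k::field, 'a) module \<Rightarrow> bool" where
  "frobenius_algebra A \<longleftrightarrow> fin_dim_algebra A \<and>
     left_module_iso A (regular_bimodule A) (dual_bimodule A) \<noteq> {}"

definition symmetric_algebra :: "('k::field, 'a) module \<Rightarrow> bool" where
  "symmetric_algebra A \<longleftrightarrow> fin_dim_algebra A \<and>
     bimodule_iso A (regular_bimodule A) (dual_bimodule A) \<noteq> {}"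


section \<open>Graded Frobenius algebras\<close>

text \<open>\<open>C g\<close> is the homogeneous component of degree \<open>g\<close>; it is only relevant for \<open>g \<in> carrier G\<close>.\<close>

definition graded_algebra ::
    "('g, 'b) monoid_scheme \<Rightarrow> ('k::field, 'a) module \<Rightarrow> ('g \<Rightarrow> 'a set) \<Rightarrow> bool" where
  "graded_algebra G A C \<longleftrightarrow> group G \<and> k_algebra A \<and>
     (\<forall>g\<in>carrier G. k_subspace A (C g)) \<and>
     (\<forall>x\<in>carrier A. \<exists>!f. f \<in> (\<Pi>\<^sub>E g\<in>carrier G. C g) \<and>
        finite {g \<in> carrier G. f g \<noteq> \<zero>\<^bsub>A\<^esub>} \<and>
        x = (\<Oplus>\<^bsub>A\<^esub>g\<in>{g \<in> carrier G. f g \<noteq> \<zero>\<^bsub>A\<^esub>}. f g)) \<and>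
     (\<forall>g\<in>carrier G. \<forall>h\<in>carrier G. \<forall>x\<in>C g. \<forall>y\<in>C h. x \<otimes>\<^bsub>A\<^esub> y \<in> C (g \<otimes>\<^bsub>G\<^esub> h))"

definition dual_component ::
    "('g, 'b) monoid_scheme \<Rightarrow> ('k::field, 'a) module \<Rightarrow> ('g \<Rightarrow> 'a set) \<Rightarrow> 'g \<Rightarrow> ('a \<Rightarrow> 'k) set"
    where
  "dual_component G A C g = {f \<in> carrier (dual_bimodule A).
     \<forall>h\<in>carrier G. h \<noteq> inv\<^bsub>G\<^esub> g \<longrightarrow> (\<forall>a\<in>C h. f a = 0)}"

definition shift_component ::
    "('g, 'b) monoid_scheme \<Rightarrow> ('g \<Rightarrow> 'a set) \<Rightarrow> 'g \<Rightarrow> 'g \<Rightarrow> 'a set" where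
  "shift_component G C \<sigma> g = C (g \<otimes>\<^bsub>G\<^esub> \<sigma>)"

definition graded_frobenius ::
    "('g, 'b) monoid_scheme \<Rightarrow> ('k::field, 'a) module \<Rightarrow> ('g \<Rightarrow> 'a set) \<Rightarrow> 'g \<Rightarrow> bool" where
  "graded_frobenius G A C \<sigma> \<longleftrightarrow> fin_dim_algebra A \<and> graded_algebra G A C \<and>
     (\<exists>\<phi>\<in>left_module_iso A (dual_bimodule A) (regular_bimodule A).
        \<forall>g\<in>carrier G. \<phi> ` dual_component G A C g \<subseteq> shift_component G C \<sigma> g)"


section \<open>Quantum polynomial algebras and their quotients by the squares of the variables\<close>

text \<open>
  Words form the free monoid, written additively because the product of \<open>'a \<Rightarrow>\<^sub>0 'k\<close> is convolution
  with respect to the addition of \<open>'a\<close>; so \<open>nat list \<Rightarrow>\<^sub>0 'k\<close> is the free algebra on letters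
  \<open>0, 1, 2, \<dots>\<close>.
\<close>

instantiation list :: (type) monoid_add
begin

definition zero_list :: "'a list" where "zero_list = []"

definition plus_list :: "'a list \<Rightarrow> 'a list \<Rightarrow> 'a list" where "plus_list u v = u @ v"

instance by standard (simp_all add: zero_list_def plus_list_def)

end

definition free_algebra :: "nat \<Rightarrow> ('k::field, nat list \<Rightarrow>\<^sub>0 'k) module" where
  "free_algebra n =
     \<lparr>carrier = {p. \<forall>w\<in>Poly_Mapping.keys p. set w \<subseteq> {1..n}},
      monoid.mult = (*), one = 1, ring.zero = 0, ring.add = (+),
      module.smult = (\<lambda>c p. Poly_Mapping.map ((*) c) p)\<rparr>"

definition free_gen :: "nat \<Rightarrow> (nat list \<Rightarrow>\<^sub>0 'k::field)" where
  "free_gen i = Poly_Mapping.single [i] 1"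

text \<open>The factor ring by an ideal, with the scalar multiplication defined like \<open>rcoset_mult\<close>.\<close>

definition quotient_algebra ::
    "('k::field, 'a) module \<Rightarrow> 'a set \<Rightarrow> ('k, 'a set) module" where
  "quotient_algebra A I =
     ring.extend (A Quot I)
       (module.fields (\<lambda>c Y. \<Union>x\<in>Y. I +>\<^bsub>A\<^esub> (c \<odot>\<^bsub>A\<^esub> x)))"

definition quantum_ideal ::
    "nat \<Rightarrow> (nat \<Rightarrow> nat \<Rightarrow> 'k::field) \<Rightarrow> (nat list \<Rightarrow>\<^sub>0 'k) set" where
  "quantum_ideal n q = Idl\<^bsub>free_algebra n\<^esub>
     {free_gen j * free_gen i - Poly_Mapping.map ((*) (q i j)) (free_gen i * free_gen j)
      | i j. 1 \<le> i \<and> i < j \<and> j \<le> n}"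

definition quantum_poly_algebra ::
    "nat \<Rightarrow> (nat \<Rightarrow> nat \<Rightarrow> 'k::field) \<Rightarrow> ('k, (nat list \<Rightarrow>\<^sub>0 'k) set) module" where
  "quantum_poly_algebra n q = quotient_algebra (free_algebra n) (quantum_ideal n q)"

definition quantum_poly_gen ::
    "nat \<Rightarrow> (nat \<Rightarrow> nat \<Rightarrow> 'k::field) \<Rightarrow> nat \<Rightarrow> (nat list \<Rightarrow>\<^sub>0 'k) set" where
  "quantum_poly_gen n q i = quantum_ideal n q +>\<^bsub>free_algebra n\<^esub> free_gen i"

definition squares_ideal ::
    "nat \<Rightarrow> (nat \<Rightarrow> nat \<Rightarrow> 'k::field) \<Rightarrow> (nat list \<Rightarrow>\<^sub>0 'k) set set" where
  "squares_ideal n q = Idl\<^bsub>quantum_poly_algebra n q\<^esub>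
     {quantum_poly_gen n q i [^]\<^bsub>quantum_poly_algebra n q\<^esub> (2::nat) | i. 1 \<le> i \<and> i \<le> n}"

definition Aq ::
    "nat \<Rightarrow> (nat \<Rightarrow> nat \<Rightarrow> 'k::field) \<Rightarrow> ('k, (nat list \<Rightarrow>\<^sub>0 'k) set set) module" where
  "Aq n q = quotient_algebra (quantum_poly_algebra n q) (squares_ideal n q)"

definition Aq_gen ::
    "nat \<Rightarrow> (nat \<Rightarrow> nat \<Rightarrow> 'k::field) \<Rightarrow> nat \<Rightarrow> (nat list \<Rightarrow>\<^sub>0 'k) set set" where
  "Aq_gen n q i = squares_ideal n q +>\<^bsub>quantum_poly_algebra n q\<^esub> quantum_poly_gen n q i"

definition Aq_monomial ::
    "nat \<Rightarrow> (nat \<Rightarrow> nat \<Rightarrow> 'k::field) \<Rightarrow> (nat \<Rightarrow> nat) \<Rightarrow> (nat list \<Rightarrow>\<^sub>0 'k) set set" where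
  "Aq_monomial n q \<epsilon> =
     foldr (\<lambda>i y. (Aq_gen n q i [^]\<^bsub>Aq n q\<^esub> \<epsilon> i) \<otimes>\<^bsub>Aq n q\<^esub> y) [1..<Suc n] \<one>\<^bsub>Aq n q\<^esub>"

definition Aq_Z_component ::
    "nat \<Rightarrow> (nat \<Rightarrow> nat \<Rightarrow> 'k::field) \<Rightarrow> int \<Rightarrow> (nat list \<Rightarrow>\<^sub>0 'k) set set set" where
  "Aq_Z_component n q d = k_span (Aq n q)
     {Aq_monomial n q \<epsilon> | \<epsilon>. \<epsilon> \<in> {1..n} \<rightarrow> {0, 1} \<and> int (\<Sum>i=1..n. \<epsilon> i) = d}"

abbreviation Z2_power :: "nat \<Rightarrow> (nat \<Rightarrow> int) monoid" where
  "Z2_power n \<equiv> product_group {1..n} (\<lambda>_. integer_mod_group 2)"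

abbreviation Z2_ones :: "nat \<Rightarrow> nat \<Rightarrow> int" where
  "Z2_ones n \<equiv> (\<lambda>i\<in>{1..n}. 1)"

text \<open>
  The elements of \<open>integer_mod_group 2\<close> are the integers \<open>0\<close> and \<open>1\<close>, so \<open>nat \<circ> \<delta>\<close> is the exponent
  vector with entries in \<open>{0, 1}\<close> whose residue class is \<open>\<delta>\<close>.
\<close>

definition Aq_Z2_component ::
    "nat \<Rightarrow> (nat \<Rightarrow> nat \<Rightarrow> 'k::field) \<Rightarrow> (nat \<Rightarrow> int) \<Rightarrow> (nat list \<Rightarrow>\<^sub>0 'k) set set set" where
  "Aq_Z2_component n q \<delta> = {c \<odot>\<^bsub>Aq n q\<^esub> Aq_monomial n q (nat \<circ> \<delta>) | c. True}"

end

theory Submission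
  imports Defs
begin

text \<open>
  Write \<open>x\<^sub>S\<close> for the product, in increasing order, of the generators with index in a subset \<open>S\<close>
  of \<open>U = {1..n}\<close>. The relations allow a word to be sorted at the cost of a non-zero scalar, and
  kill a word with a repeated letter; so \<open>x\<^sub>S x\<^sub>T\<close> is \<open>reorder q S T\<close> times \<open>x\<^bsub>S \<union> T\<^esub>\<close> if \<open>S\<close> and
  \<open>T\<close> are disjoint, and zero otherwise. Everything in the theorem follows from this and from the
  fact that the \<open>x\<^sub>S\<close> form a basis, which the locale \<open>quantum_exterior\<close> expresses by coordinate
  functionals.

  Let \<open>\<lambda>\<close> be the coordinate at the top monomial \<open>x\<^sub>U\<close>. The pairing \<open>(a, b) \<mapsto> \<lambda>(a b)\<close> matches
  \<open>x\<^sub>S\<close> with \<open>x\<^bsub>U - S\<^esub>\<close>, and its value there is a non-zero reordering factor. Hence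
  \<open>x \<mapsto> (a \<mapsto> \<lambda>(a x))\<close> is an isomorphism of \<open>A\<close> with its dual as left modules. If for each
  generator \<open>x\<^sub>i\<close> the factors for moving it through all other generators from the left and from
  the right agree, then \<open>\<lambda>(a b) = \<lambda>(b a)\<close> and the isomorphism is one of bimodules. Conversely, a
  bimodule isomorphism yields a functional \<open>l\<close> with \<open>l(a b) = l(b a)\<close>, and \<open>l\<close> does not vanish at
  \<open>x\<^sub>U\<close>, because otherwise \<open>x\<^sub>U\<close> would annihilate \<open>l\<close>; comparing \<open>l\<close> at the products of \<open>x\<^sub>i\<close>
  with the remaining generators gives the agreement of the factors. The condition at \<open>i = n\<close>
  follows from the others, since the product over all \<open>i\<close> of the left factors is equal to that of
  the right factors (\<open>reorder_commute_iff\<close>).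

  For a grading in which the \<open>x\<^sub>S\<close> are homogeneous of degree \<open>deg S\<close>, the isomorphism above is
  graded for the shift by \<open>deg U\<close>. No other shift is possible: \<open>\<lambda>\<close> generates the dual and is
  homogeneous, so its image under a graded isomorphism onto \<open>A\<close> generates \<open>A\<close> and is homogeneous;
  since \<open>1\<close> is a left multiple of the image, its coordinate at the empty set is non-zero, which
  fixes its degree. Both gradings are instances.

  It remains to show that the \<open>x\<^sub>S\<close> are a basis of the iterated quotient. They span by
  straightening of words. For independence, each word in the free algebra is given the
  coordinates that straightening would produce (\<open>word_coord\<close>). The product rule \<open>word_coord_mult\<close>
  shows that the common kernel of these coordinates is an ideal; it contains the defining
  relations, hence the coordinates descend to the quotient.
\<close>

section \<open>Quotients of algebras by ideals\<close>

text \<open>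
  Surjective homomorphisms of \<open>K\<close>-algebras, by which the two successive quotients are treated as
  one.
\<close>

definition k_algebra_epi ::
    "('k::field, 'a) module \<Rightarrow> ('k, 'b) module \<Rightarrow> ('a \<Rightarrow> 'b) \<Rightarrow> bool" where
  "k_algebra_epi A B h \<longleftrightarrow> h ` carrier A = carrier B \<and> h \<one>\<^bsub>A\<^esub> = \<one>\<^bsub>B\<^esub> \<and>
     (\<forall>x\<in>carrier A. \<forall>y\<in>carrier A. h (x \<oplus>\<^bsub>A\<^esub> y) = h x \<oplus>\<^bsub>B\<^esub> h y) \<and>
     (\<forall>x\<in>carrier A. \<forall>y\<in>carrier A. h (x \<otimes>\<^bsub>A\<^esub> y) = h x \<otimes>\<^bsub>B\<^esub> h y) \<and>
     (\<forall>c. \<forall>x\<in>carrier A. h (c \<odot>\<^bsub>A\<^esub> x) = c \<odot>\<^bsub>B\<^esub> h x)"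

lemma k_algebra_epiD:
  assumes "k_algebra_epi A B h"
  shows "x \<in> carrier A \<Longrightarrow> h x \<in> carrier B"
    and "h ` carrier A = carrier B"
    and "h \<one>\<^bsub>A\<^esub> = \<one>\<^bsub>B\<^esub>"
    and "x \<in> carrier A \<Longrightarrow> y \<in> carrier A \<Longrightarrow> h (x \<oplus>\<^bsub>A\<^esub> y) = h x \<oplus>\<^bsub>B\<^esub> h y"
    and "x \<in> carrier A \<Longrightarrow> y \<in> carrier A \<Longrightarrow> h (x \<otimes>\<^bsub>A\<^esub> y) = h x \<otimes>\<^bsub>B\<^esub> h y"
    and "x \<in> carrier A \<Longrightarrow> h (c \<odot>\<^bsub>A\<^esub> x) = c \<odot>\<^bsub>B\<^esub> h x"
  using assms by (auto simp: k_algebra_epi_def)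

lemma k_algebra_epi_comp:
  assumes "k_algebra A" and g: "k_algebra_epi A B g" and h: "k_algebra_epi B C h"
  shows "k_algebra_epi A C (\<lambda>x. h (g x))"
proof -
  interpret k_algebra A by fact
  have "g x \<in> carrier B" if "x \<in> carrier A" for x
    using g that by (auto simp: k_algebra_epi_def)
  moreover have "(\<lambda>x. h (g x)) ` carrier A = h ` g ` carrier A"
    by (simp add: image_image)
  ultimately show ?thesis
    using g h by (simp add: k_algebra_epi_def)
qed

text \<open>
  The factor ring carries no scalar multiplication. The next two lemmas transfer the ring
  structure and the ideals to the record that is extended by one.
\<close>

lemma ring_extend:
  fixes R (structure)
  assumes "ring R"
  shows "ring (ring.extend R M)"
proof -
  interpret ring R by fact
  show ?thesis
  proof (intro ringI abelian_groupI monoidI)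
    fix x assume "x \<in> carrier (ring.extend R M)"
    then have "\<ominus> x \<in> carrier R" "\<ominus> x \<oplus> x = \<zero>" by (simp_all add: ring.defs l_neg)
    then show "\<exists>y\<in>carrier (ring.extend R M). y \<oplus>\<^bsub>ring.extend R M\<^esub> x = \<zero>\<^bsub>ring.extend R M\<^esub>"
      by (auto simp: ring.defs)
  qed (simp_all add: ring.defs a_ac m_assoc l_distr r_distr)
qed

lemma ideal_extend:
  assumes "ideal J R"
  shows "ideal J (ring.extend R M)"
proof -
  interpret ideal J R by fact
  have ring': "ring (ring.extend R M)" by (rule ring_extend) (rule ring_axioms)
  interpret R': ring "ring.extend R M" by (rule ring')
  show ?thesis
  proof (rule idealI[OF ring'])
    show "subgroup J (add_monoid (ring.extend R M))"
    proof (rule R'.add.subgroupI)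
      show "J \<subseteq> carrier (ring.extend R M)" using a_subset by (simp add: ring.defs)
      show "J \<noteq> {}" using additive_subgroup.zero_closed[OF is_additive_subgroup] by blast
      fix a assume a: "a \<in> J"
      then have "a \<in> carrier R" "\<ominus>\<^bsub>R\<^esub> a \<in> carrier R" "\<ominus>\<^bsub>R\<^esub> a \<oplus>\<^bsub>R\<^esub> a = \<zero>\<^bsub>R\<^esub>"
        using a_Hcarr by (auto simp: l_neg)
      then have "\<ominus>\<^bsub>ring.extend R M\<^esub> a = \<ominus>\<^bsub>R\<^esub> a"
        by (intro R'.minus_equality) (simp_all add: ring.defs)
      then show "\<ominus>\<^bsub>ring.extend R M\<^esub> a \<in> J" using a by simp
    next
      fix a b assume "a \<in> J" "b \<in> J"
      then show "a \<oplus>\<^bsub>ring.extend R M\<^esub> b \<in> J" by (simp add: ring.defs)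
    qed
  qed (auto simp: ring.defs I_l_closed I_r_closed)
qed

context k_algebra
begin

lemma ideal_smult_closed:
  assumes "ideal I A" "x \<in> I"
  shows "c \<odot> x \<in> I"
proof -
  interpret ideal I A by fact
  have "x \<in> carrier A" using assms(2) a_Hcarr by blast
  then have "c \<odot> x = (c \<odot> \<one>) \<otimes> x" by (simp add: smult_mult_left)
  then show ?thesis using assms(2) I_l_closed smult_closed[OF one_closed] by simp
qed

lemma smult_minus:
  assumes "x \<in> carrier A" "y \<in> carrier A"
  shows "c \<odot> (x \<ominus> y) = c \<odot> x \<ominus> c \<odot> y"
proof -
  have "c \<odot> (x \<ominus> y) \<oplus> c \<odot> y = c \<odot> x"
    using assms by (subst smult_add_right[symmetric]) (simp_all add: minus_eq a_assoc l_neg)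
  then have "c \<odot> x \<ominus> c \<odot> y = c \<odot> (x \<ominus> y) \<oplus> c \<odot> y \<ominus> c \<odot> y" by simp
  then show ?thesis using assms smult_closed by (simp add: minus_eq a_assoc r_neg)
qed

lemma quotient_algebra_epi:
  assumes I: "ideal I A"
  shows "k_algebra (quotient_algebra A I)"
    and "k_algebra_epi A (quotient_algebra A I) (\<lambda>x. I +> x)"
proof -
  interpret I: ideal I A by fact
  let ?Q = "quotient_algebra A I"
  have ring_Q: "ring ?Q"
    unfolding quotient_algebra_def by (rule ring_extend) (rule I.quotient_is_ring)
  have carrier: "carrier ?Q = (\<lambda>x. I +> x) ` carrier A"
    by (auto simp: quotient_algebra_def ring.defs FactRing_def A_RCOSETS_def')
  have one: "\<one>\<^bsub>?Q\<^esub> = I +> \<one>"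
    by (simp add: quotient_algebra_def ring.defs FactRing_def)
  have add: "(I +> x) \<oplus>\<^bsub>?Q\<^esub> (I +> y) = I +> (x \<oplus> y)"
    if "x \<in> carrier A" "y \<in> carrier A" for x y
    using that by (simp add: quotient_algebra_def ring.defs FactRing_def I.a_rcos_sum)
  have mult: "(I +> x) \<otimes>\<^bsub>?Q\<^esub> (I +> y) = I +> (x \<otimes> y)"
    if "x \<in> carrier A" "y \<in> carrier A" for x y
    using that by (simp add: quotient_algebra_def ring.defs FactRing_def I.rcoset_mult_add)
  \<comment> \<open>The union in the definition of the scalar multiplication consists of one coset only.\<close>
  have smult: "c \<odot>\<^bsub>?Q\<^esub> (I +> x) = I +> (c \<odot> x)" if x: "x \<in> carrier A" for c x
  proof -
    have "I +> (c \<odot> y) = I +> (c \<odot> x)" if "y \<in> I +> x" for y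
    proof -
      have y: "y \<in> carrier A" using that x I.a_subset a_r_coset_subset_G by blast
      have "I +> y = I +> x"
        using I.a_repr_independence'[OF that x] by simp
      then have "y \<ominus> x \<in> I" using quotient_eq_iff_same_a_r_cos[OF I y x] by simp
      then have "c \<odot> y \<ominus> c \<odot> x \<in> I" using ideal_smult_closed[OF I] smult_minus[OF y x] by metis
      then show ?thesis
        using quotient_eq_iff_same_a_r_cos[OF I smult_closed[OF y] smult_closed[OF x]] by simp
    qed
    moreover have "x \<in> I +> x" using x I.a_rcos_self by blast
    ultimately have "(\<Union>y\<in>I +> x. I +> (c \<odot> y)) = I +> (c \<odot> x)" by blast
    then show ?thesis by (simp add: quotient_algebra_def ring.defs module.defs)
  qed
  show "k_algebra ?Q"
  proof (rule k_algebra.intro[OF ring_Q], unfold_locales)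
    fix x c assume "x \<in> carrier ?Q"
    then show "c \<odot>\<^bsub>?Q\<^esub> x \<in> carrier ?Q" by (auto simp: carrier smult smult_closed)
  next
    fix x c d assume "x \<in> carrier ?Q"
    then show "(c + d) \<odot>\<^bsub>?Q\<^esub> x = c \<odot>\<^bsub>?Q\<^esub> x \<oplus>\<^bsub>?Q\<^esub> d \<odot>\<^bsub>?Q\<^esub> x"
      by (auto simp: carrier smult add smult_closed smult_add_left)
  next
    fix x y c assume "x \<in> carrier ?Q" "y \<in> carrier ?Q"
    then show "c \<odot>\<^bsub>?Q\<^esub> (x \<oplus>\<^bsub>?Q\<^esub> y) = c \<odot>\<^bsub>?Q\<^esub> x \<oplus>\<^bsub>?Q\<^esub> c \<odot>\<^bsub>?Q\<^esub> y"
      by (auto simp: carrier smult add smult_closed smult_add_right)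
  next
    fix x c d assume "x \<in> carrier ?Q"
    then show "(c * d) \<odot>\<^bsub>?Q\<^esub> x = c \<odot>\<^bsub>?Q\<^esub> (d \<odot>\<^bsub>?Q\<^esub> x)"
      by (auto simp: carrier smult smult_closed smult_smult)
  next
    fix x assume "x \<in> carrier ?Q"
    then show "1 \<odot>\<^bsub>?Q\<^esub> x = x" by (auto simp: carrier smult smult_1)
  next
    fix x y c assume "x \<in> carrier ?Q" "y \<in> carrier ?Q"
    then show "(c \<odot>\<^bsub>?Q\<^esub> x) \<otimes>\<^bsub>?Q\<^esub> y = c \<odot>\<^bsub>?Q\<^esub> (x \<otimes>\<^bsub>?Q\<^esub> y)"
      by (auto simp: carrier smult mult smult_closed smult_mult_left)
  next
    fix x y c assume "x \<in> carrier ?Q" "y \<in> carrier ?Q"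
    then show "x \<otimes>\<^bsub>?Q\<^esub> (c \<odot>\<^bsub>?Q\<^esub> y) = c \<odot>\<^bsub>?Q\<^esub> (x \<otimes>\<^bsub>?Q\<^esub> y)"
      by (auto simp: carrier smult mult smult_closed smult_mult_right)
  qed
  show "k_algebra_epi A ?Q (\<lambda>x. I +> x)"
    by (auto simp: k_algebra_epi_def carrier one add mult smult)
qed

lemma ideal_image_quotient_algebra:
  assumes "ideal I A" "ideal J A"
  shows "ideal ((\<lambda>x. I +> x) ` J) (quotient_algebra A I)"
  unfolding quotient_algebra_def
  by (rule ideal_extend) (rule ring_ideal_imp_quot_ideal[OF assms])

end

section \<open>Scalars that arise from reordering a product of generators\<close>

text \<open>
  The scalar that arises when the sorted product of the generators in \<open>S\<close>, followed by that of
  the generators in \<open>T\<close>, is sorted: every pair \<open>t < s\<close> contributes \<open>q t s\<close>, because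
  \<open>x\<^sub>s x\<^sub>t = q\<^sub>t\<^sub>s x\<^sub>t x\<^sub>s\<close>. The definition does not require \<open>S\<close> and \<open>T\<close> to be disjoint; a pair
  of equal indices contributes \<open>1\<close>. The factor is multiplicative in both arguments with respect
  to disjoint unions.
\<close>

definition reorder :: "(nat \<Rightarrow> nat \<Rightarrow> 'k::field) \<Rightarrow> nat set \<Rightarrow> nat set \<Rightarrow> 'k" where
  "reorder q S T = (\<Prod>s\<in>S. \<Prod>t\<in>T. if t < s then q t s else 1)"

lemma reorder_empty [simp]: "reorder q {} T = 1" "reorder q S {} = 1"
  by (simp_all add: reorder_def)

lemma reorder_prod_left: "reorder q S T = (\<Prod>s\<in>S. reorder q {s} T)"
  by (simp add: reorder_def)

lemma reorder_prod_right: "reorder q S T = (\<Prod>t\<in>T. reorder q S {t})"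
  unfolding reorder_def by (subst prod.swap) simp

lemma reorder_Un_left:
  assumes "finite S" "finite S'" "S \<inter> S' = {}"
  shows "reorder q (S \<union> S') T = reorder q S T * reorder q S' T"
  unfolding reorder_def by (rule prod.union_disjoint[OF assms])

lemma reorder_Un_right:
  assumes "finite T" "finite T'" "T \<inter> T' = {}"
  shows "reorder q S (T \<union> T') = reorder q S T * reorder q S T'"
  unfolding reorder_def by (simp add: prod.union_disjoint[OF assms] prod.distrib)

lemma reorder_singleton [simp]: "reorder q {i} {i} = 1"
  by (simp add: reorder_def)

lemma reorder_singleton_left:
  "reorder q {i} {1..n} = (\<Prod>p\<in>{1..<i}. q p i)" if "i \<in> {1..n}"
proof -
  have "reorder q {i} {1..n} = (\<Prod>p\<in>{1..n}. if p < i then q p i else 1)"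
    by (simp add: reorder_def)
  also have "\<dots> = (\<Prod>p\<in>{1..<i}. if p < i then q p i else 1)"
    by (rule prod.mono_neutral_right) (use that in auto)
  finally show ?thesis by simp
qed

lemma reorder_singleton_right:
  "reorder q {1..n} {i} = (\<Prod>p\<in>{i<..n}. q i p)" if "i \<in> {1..n}"
proof -
  have "reorder q {1..n} {i} = (\<Prod>p\<in>{1..n}. if i < p then q i p else 1)"
    by (simp add: reorder_def)
  also have "\<dots> = (\<Prod>p\<in>{i<..n}. if i < p then q i p else 1)"
    by (rule prod.mono_neutral_right) (use that in auto)
  finally show ?thesis by simp
qed

text \<open>
  The scalar by which a word without repeated letters differs from the sorted word.
\<close>

fun sort_factor :: "(nat \<Rightarrow> nat \<Rightarrow> 'k::field) \<Rightarrow> nat list \<Rightarrow> 'k" where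
  "sort_factor q [] = 1"
| "sort_factor q (i # w) = reorder q {i} (set w) * sort_factor q w"

lemma sort_factor_append:
  assumes "distinct (u @ v)"
  shows "sort_factor q (u @ v) = reorder q (set u) (set v) * sort_factor q u * sort_factor q v"
  using assms
proof (induction u)
  case (Cons i u)
  have "reorder q {i} (set u \<union> set v) = reorder q {i} (set u) * reorder q {i} (set v)"
    using Cons.prems by (intro reorder_Un_right) auto
  moreover have "reorder q ({i} \<union> set u) (set v) = reorder q {i} (set v) * reorder q (set u) (set v)"
    using Cons.prems by (intro reorder_Un_left) auto
  ultimately show ?case using Cons by simp
qed simp

lemma reorder_eq_1:
  assumes "\<And>t. t \<in> T \<Longrightarrow> i \<le> t"
  shows "reorder q {i} T = 1"
  using assms by (force simp: reorder_def intro!: prod.neutral)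

lemma sort_factor_sorted: "sorted w \<Longrightarrow> sort_factor q w = 1"
  by (induction w) (simp_all add: reorder_eq_1)

text \<open>
  The condition for \<open>i = n\<close> is redundant: the product over all \<open>i\<close> of \<open>reorder q {i} {1..n}\<close> and
  that of \<open>reorder q {1..n} {i}\<close> are both \<open>reorder q {1..n} {1..n}\<close>.
\<close>

lemma reorder_commute_iff:
  fixes q :: "nat \<Rightarrow> nat \<Rightarrow> 'k::field"
  assumes "n \<ge> 1" and q: "\<And>i j. 1 \<le> i \<Longrightarrow> i < j \<Longrightarrow> j \<le> n \<Longrightarrow> q i j \<noteq> 0"
  shows "(\<forall>i\<in>{1..n}. reorder q {i} {1..n} = reorder q {1..n} {i}) \<longleftrightarrow>
    (\<forall>i\<in>{1..n-1}. q i n = (\<Prod>p\<in>{1..<i}. q p i) * (\<Prod>p\<in>{i<..n-1}. inverse (q i p)))"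
proof -
  have iff: "reorder q {i} {1..n} = reorder q {1..n} {i} \<longleftrightarrow>
      q i n = (\<Prod>p\<in>{1..<i}. q p i) * (\<Prod>p\<in>{i<..n-1}. inverse (q i p))"
    if i: "i \<in> {1..n-1}" for i
  proof -
    have "i \<in> {1..n}" and split: "{i<..n} = insert n {i<..n-1}" and "n \<notin> {i<..n-1}"
      using i by auto
    then have right: "reorder q {1..n} {i} = q i n * (\<Prod>p\<in>{i<..n-1}. q i p)"
      using prod.insert[of "{i<..n-1}" n "q i"] by (simp only: reorder_singleton_right split) simp
    have "(\<Prod>p\<in>{i<..n-1}. q i p) \<noteq> 0" using q i by (auto simp: prod_zero_iff)
    moreover have "(\<Prod>p\<in>{i<..n-1}. inverse (q i p)) = inverse (\<Prod>p\<in>{i<..n-1}. q i p)"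
      by (simp add: prod_inversef[symmetric] comp_def)
    ultimately show ?thesis
      unfolding right reorder_singleton_left[OF \<open>i \<in> {1..n}\<close>] by (auto simp: field_simps)
  qed
  have last: "reorder q {n} {1..n} = reorder q {1..n} {n}"
    if eq: "\<And>i. i \<in> {1..n-1} \<Longrightarrow> reorder q {i} {1..n} = reorder q {1..n} {i}"
  proof -
    have U: "{1..n} = insert n {1..n-1}" "n \<notin> {1..n-1}" using assms(1) by auto
    have split: "prod f {1..n} = f n * prod f {1..n-1}" for f :: "nat \<Rightarrow> 'k"
      by (subst U(1), rule prod.insert) (use U(2) in auto)
    have nz: "(\<Prod>i\<in>{1..n-1}. reorder q {i} {1..n}) \<noteq> 0"
      using q by (auto simp: reorder_def prod_zero_iff)
    have "reorder q {n} {1..n} * (\<Prod>i\<in>{1..n-1}. reorder q {i} {1..n}) =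
        (\<Prod>i\<in>{1..n}. reorder q {i} {1..n})"
      by (rule split[symmetric])
    also have "\<dots> = reorder q {1..n} {1..n}" by (rule reorder_prod_left[symmetric])
    also have "\<dots> = (\<Prod>i\<in>{1..n}. reorder q {1..n} {i})" by (rule reorder_prod_right)
    also have "\<dots> = reorder q {1..n} {n} * (\<Prod>i\<in>{1..n-1}. reorder q {1..n} {i})"
      by (rule split)
    also have "(\<Prod>i\<in>{1..n-1}. reorder q {1..n} {i}) = (\<Prod>i\<in>{1..n-1}. reorder q {i} {1..n})"
      using eq by simp
    finally show ?thesis using nz by simp
  qed
  have "(\<forall>i\<in>{1..n}. reorder q {i} {1..n} = reorder q {1..n} {i}) \<longleftrightarrow>
      (\<forall>i\<in>{1..n-1}. reorder q {i} {1..n} = reorder q {1..n} {i})"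
  proof
    assume *: "\<forall>i\<in>{1..n-1}. reorder q {i} {1..n} = reorder q {1..n} {i}"
    show "\<forall>i\<in>{1..n}. reorder q {i} {1..n} = reorder q {1..n} {i}"
    proof
      fix i assume "i \<in> {1..n}"
      then have "i \<in> {1..n-1} \<or> i = n" by auto
      then show "reorder q {i} {1..n} = reorder q {1..n} {i}" using * last by blast
    qed
  qed auto
  also have "\<dots> \<longleftrightarrow> (\<forall>i\<in>{1..n-1}. q i n = (\<Prod>p\<in>{1..<i}. q p i) * (\<Prod>p\<in>{i<..n-1}. inverse (q i p)))"
    by (rule ball_cong[OF refl iff])
  finally show ?thesis .
qed

section \<open>Algebras with the coordinates and the product of a quantum exterior algebra\<close>

lemma finsum_additive:
  fixes f :: "'a \<Rightarrow> 'b::ab_group_add"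
  assumes "abelian_group A" and "finite T" and "g \<in> T \<rightarrow> carrier A"
    and add: "\<And>x y. x \<in> carrier A \<Longrightarrow> y \<in> carrier A \<Longrightarrow> f (x \<oplus>\<^bsub>A\<^esub> y) = f x + f y"
  shows "f (\<Oplus>\<^bsub>A\<^esub>b\<in>T. g b) = (\<Sum>b\<in>T. f (g b))"
proof -
  interpret abelian_group A by fact
  have "f \<zero>\<^bsub>A\<^esub> = f \<zero>\<^bsub>A\<^esub> + f \<zero>\<^bsub>A\<^esub>"
    using add[of "\<zero>\<^bsub>A\<^esub>" "\<zero>\<^bsub>A\<^esub>"] by simp
  then have "f \<zero>\<^bsub>A\<^esub> = 0" by simp
  with \<open>finite T\<close> \<open>g \<in> T \<rightarrow> carrier A\<close> show ?thesis
    by (induction T) (auto simp: add)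
qed

text \<open>
  An algebra with a basis indexed by the subsets of a finite set \<open>U\<close> and with the product of the
  quantum exterior algebra, described by its coordinate functionals: \<open>coord x S\<close> is the
  coefficient of the sorted monomial with index set \<open>S\<close>. Values of \<open>coord x\<close> at sets that are not
  contained in \<open>U\<close> are irrelevant.
\<close>

locale quantum_exterior = k_algebra A
  for A :: "('k::field, 'a) module" (structure) +
  fixes U :: "nat set" and q :: "nat \<Rightarrow> nat \<Rightarrow> 'k" and coord :: "'a \<Rightarrow> nat set \<Rightarrow> 'k"
  assumes finite_U: "finite U"
    and q_nonzero: "i \<in> U \<Longrightarrow> j \<in> U \<Longrightarrow> i < j \<Longrightarrow> q i j \<noteq> 0"
    and coord_add: "x \<in> carrier A \<Longrightarrow> y \<in> carrier A \<Longrightarrow> S \<subseteq> U \<Longrightarrow>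
      coord (x \<oplus> y) S = coord x S + coord y S"
    and coord_smult: "x \<in> carrier A \<Longrightarrow> S \<subseteq> U \<Longrightarrow> coord (c \<odot> x) S = c * coord x S"
    and coord_inj: "x \<in> carrier A \<Longrightarrow> y \<in> carrier A \<Longrightarrow>
      (\<And>S. S \<subseteq> U \<Longrightarrow> coord x S = coord y S) \<Longrightarrow> x = y"
    and coord_surj: "\<exists>x\<in>carrier A. \<forall>S\<subseteq>U. coord x S = f S"
    and coord_one: "S \<subseteq> U \<Longrightarrow> coord \<one> S = (if S = {} then 1 else 0)"
    and coord_mult: "x \<in> carrier A \<Longrightarrow> y \<in> carrier A \<Longrightarrow> S \<subseteq> U \<Longrightarrow>
      coord (x \<otimes> y) S = (\<Sum>T\<in>Pow S. reorder q T (S - T) * coord x T * coord y (S - T))"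
begin

text \<open>
  The element with the coordinates \<open>f\<close> at the subsets of \<open>U\<close>; it is unique by \<open>coord_inj\<close>.
\<close>

definition vec :: "(nat set \<Rightarrow> 'k) \<Rightarrow> 'a" where
  "vec f = (SOME x. x \<in> carrier A \<and> (\<forall>S\<subseteq>U. coord x S = f S))"

lemma vec_closed [simp]: "vec f \<in> carrier A"
  and coord_vec [simp]: "S \<subseteq> U \<Longrightarrow> coord (vec f) S = f S"
proof -
  have "\<exists>x. x \<in> carrier A \<and> (\<forall>S\<subseteq>U. coord x S = f S)"
    using coord_surj[of f] by blast
  then have "vec f \<in> carrier A \<and> (\<forall>S\<subseteq>U. coord (vec f) S = f S)"
    unfolding vec_def by (rule someI_ex)
  then show "vec f \<in> carrier A" "S \<subseteq> U \<Longrightarrow> coord (vec f) S = f S" by auto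
qed

text \<open>
  The basis element with index set \<open>S\<close>.
\<close>

definition mon :: "nat set \<Rightarrow> 'a" where
  "mon S = vec (\<lambda>T. if T = S then 1 else 0)"

lemma mon_closed [simp]: "mon S \<in> carrier A"
  by (simp add: mon_def)

lemma coord_mon [simp]: "T \<subseteq> U \<Longrightarrow> coord (mon S) T = (if T = S then 1 else 0)"
  by (simp add: mon_def)

lemma coord_zero [simp]: "S \<subseteq> U \<Longrightarrow> coord \<zero> S = 0"
  using coord_add[of \<zero> \<zero> S] by (metis add_cancel_right_right l_zero zero_closed)

lemma coord_finsum:
  assumes "finite T" "g \<in> T \<rightarrow> carrier A" "S \<subseteq> U"
  shows "coord (\<Oplus>b\<in>T. g b) S = (\<Sum>b\<in>T. coord (g b) S)"
  using finsum_additive[OF abelian_group_axioms assms(1,2), of "\<lambda>x. coord x S"] coord_add assms(3)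
  by blast

lemma inj_mon: "inj_on mon (Pow U)"
proof (rule inj_onI)
  fix S T assume "S \<in> Pow U" "T \<in> Pow U" "mon S = mon T"
  then have "coord (mon S) S = coord (mon T) S" by simp
  with \<open>S \<in> _\<close> show "S = T" by (simp split: if_splits)
qed

lemma reorder_nonzero:
  assumes "S \<subseteq> U" "T \<subseteq> U"
  shows "reorder q S T \<noteq> 0"
proof -
  have "finite S" "finite T" using assms finite_U finite_subset by blast+
  then show ?thesis using assms q_nonzero by (auto simp: reorder_def subset_iff)
qed

lemma k_span_mon:
  assumes F: "F \<subseteq> Pow U"
  shows "k_span A (mon ` F) = {x \<in> carrier A. \<forall>S\<subseteq>U. coord x S \<noteq> 0 \<longrightarrow> S \<in> F}"
proof (intro equalityI subsetI)
  fix x assume "x \<in> k_span A (mon ` F)"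
  then obtain T c where T: "finite T" "T \<subseteq> mon ` F" and x: "x = (\<Oplus>b\<in>T. c b \<odot> b)"
    unfolding k_span_def by blast
  have closed: "(\<lambda>b. c b \<odot> b) \<in> T \<rightarrow> carrier A"
    using T(2) smult_closed by auto
  have "coord x S = 0" if "S \<subseteq> U" "S \<notin> F" for S
  proof -
    have "coord (c b \<odot> b) S = 0" if b: "b \<in> T" for b
    proof -
      obtain R where "R \<in> F" "b = mon R" using b T(2) by blast
      then show ?thesis using that \<open>S \<subseteq> U\<close> \<open>S \<notin> F\<close> by (auto simp: coord_smult)
    qed
    then show ?thesis using that T(1) closed by (simp add: x coord_finsum)
  qed
  then show "x \<in> {x \<in> carrier A. \<forall>S\<subseteq>U. coord x S \<noteq> 0 \<longrightarrow> S \<in> F}"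
    using closed T(1) by (auto simp: x)
next
  fix x assume "x \<in> {x \<in> carrier A. \<forall>S\<subseteq>U. coord x S \<noteq> 0 \<longrightarrow> S \<in> F}"
  then have x: "x \<in> carrier A" "\<And>S. S \<subseteq> U \<Longrightarrow> coord x S \<noteq> 0 \<Longrightarrow> S \<in> F" by auto
  have fin: "finite F" using F finite_U finite_subset by blast
  define c where "c = (\<lambda>b. coord x (inv_into F mon b))"
  have inj: "inj_on mon F" using inj_mon F inj_on_subset by blast
  have closed: "(\<lambda>b. c b \<odot> b) \<in> mon ` F \<rightarrow> carrier A" using smult_closed by auto
  have "x = (\<Oplus>b\<in>mon ` F. c b \<odot> b)"
  proof (rule coord_inj)
    fix S assume S: "S \<subseteq> U"
    have "coord (\<Oplus>b\<in>mon ` F. c b \<odot> b) S = (\<Sum>b\<in>mon ` F. coord (c b \<odot> b) S)"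
      using fin closed S by (intro coord_finsum) auto
    also have "\<dots> = (\<Sum>R\<in>F. coord (c (mon R) \<odot> mon R) S)"
      by (rule sum.reindex[OF inj, unfolded comp_def])
    also have "\<dots> = (\<Sum>R\<in>F. if S = R then coord x R else 0)"
      using S by (intro sum.cong refl) (auto simp: coord_smult c_def inv_into_f_f[OF inj])
    also have "\<dots> = coord x S" using fin x(2)[OF S] by auto
    finally show "coord x S = coord (\<Oplus>b\<in>mon ` F. c b \<odot> b) S" by simp
  qed (use x closed fin in \<open>auto intro!: finsum_closed\<close>)
  then show "x \<in> k_span A (mon ` F)"
    unfolding k_span_def using fin by blast
qed

lemma k_span_mon_all: "k_span A (mon ` Pow U) = carrier A"
  by (subst k_span_mon) auto

lemma k_span_mon_singleton:
  assumes S: "S \<subseteq> U"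
  shows "k_span A {mon S} = {c \<odot> mon S |c. True}"
proof -
  have span: "k_span A {mon S} = {x \<in> carrier A. \<forall>T\<subseteq>U. coord x T \<noteq> 0 \<longrightarrow> T \<in> {S}}"
    using k_span_mon[of "{S}"] S by simp
  show ?thesis
  proof (intro equalityI subsetI)
    fix x assume "x \<in> k_span A {mon S}"
    then have x: "x \<in> carrier A" and T: "\<And>T. T \<subseteq> U \<Longrightarrow> coord x T \<noteq> 0 \<Longrightarrow> T = S"
      by (auto simp: span)
    have "x = coord x S \<odot> mon S"
    proof (rule coord_inj[OF x smult_closed[OF mon_closed]])
      fix T assume "T \<subseteq> U"
      then show "coord x T = coord (coord x S \<odot> mon S) T"
        using T by (auto simp: coord_smult)
    qed
    then show "x \<in> {c \<odot> mon S |c. True}" by blast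
  qed (auto simp: span smult_closed coord_smult split: if_splits)
qed

lemma fin_dim: "fin_dim_algebra A"
  unfolding fin_dim_algebra_def
  using k_span_mon_all k_algebra_axioms finite_U
  by (intro conjI exI[of _ "mon ` Pow U"]) auto

lemma mon_mult:
  assumes "S \<subseteq> U" "T \<subseteq> U" "S \<inter> T = {}"
  shows "mon S \<otimes> mon T = reorder q S T \<odot> mon (S \<union> T)"
proof (rule coord_inj)
  fix R assume R: "R \<subseteq> U"
  then have fin: "finite (Pow R)" using finite_U finite_subset by blast
  have "coord (mon S \<otimes> mon T) R
      = (\<Sum>P\<in>Pow R. reorder q P (R - P) * coord (mon S) P * coord (mon T) (R - P))"
    using R by (simp add: coord_mult)
  also have "\<dots>
      = (\<Sum>P\<in>Pow R. if S = P then (if R - S = T then reorder q S T else 0) else 0)"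
  proof (intro sum.cong refl)
    fix P assume "P \<in> Pow R"
    then have "P \<subseteq> U" "R - P \<subseteq> U" using R by auto
    then show "reorder q P (R - P) * coord (mon S) P * coord (mon T) (R - P)
        = (if S = P then (if R - S = T then reorder q S T else 0) else 0)"
      by simp
  qed
  also have "\<dots> = (if S \<subseteq> R \<and> R - S = T then reorder q S T else 0)"
    using fin by simp
  also have "S \<subseteq> R \<and> R - S = T \<longleftrightarrow> R = S \<union> T"
    using assms(3) by blast
  finally show "coord (mon S \<otimes> mon T) R = coord (reorder q S T \<odot> mon (S \<union> T)) R"
    using R by (simp add: coord_smult)
qed (auto simp: smult_closed)

lemma mult_mon_top:
  assumes "x \<in> carrier A"
  shows "x \<otimes> mon U = coord x {} \<odot> mon U"
proof (rule coord_inj)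
  fix R assume R: "R \<subseteq> U"
  then have fin: "finite (Pow R)" using finite_U finite_subset by blast
  have "coord (x \<otimes> mon U) R
      = (\<Sum>P\<in>Pow R. reorder q P (R - P) * coord x P * coord (mon U) (R - P))"
    using R assms by (simp add: coord_mult)
  also have "\<dots> = (\<Sum>P\<in>Pow R. if {} = P then (if R = U then coord x {} else 0) else 0)"
  proof (intro sum.cong refl)
    fix P assume "P \<in> Pow R"
    then have "R - P \<subseteq> U" "R - P = U \<longleftrightarrow> P = {} \<and> R = U" using R by auto
    then show "reorder q P (R - P) * coord x P * coord (mon U) (R - P)
        = (if {} = P then (if R = U then coord x {} else 0) else 0)"
      by auto
  qed
  also have "\<dots> = (if R = U then coord x {} else 0)"
    using fin by simp
  finally show "coord (x \<otimes> mon U) R = coord (coord x {} \<odot> mon U) R"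
    using R by (simp add: coord_smult)
qed (auto simp: smult_closed assms)

section \<open>The Frobenius frob_map and its symmetry\<close>

abbreviation dual :: "('a \<Rightarrow> 'k) set" where
  "dual \<equiv> carrier (dual_bimodule A)"

lemma dual_add: "f \<in> dual \<Longrightarrow> x \<in> carrier A \<Longrightarrow> y \<in> carrier A \<Longrightarrow> f (x \<oplus> y) = f x + f y"
  and dual_smult: "f \<in> dual \<Longrightarrow> x \<in> carrier A \<Longrightarrow> f (c \<odot> x) = c * f x"
  by (auto simp: dual_bimodule_def)

text \<open>
  A functional is determined by its values on the basis.
\<close>

lemma dual_eqI:
  assumes f: "f \<in> dual" and g: "g \<in> dual"
    and eq: "\<And>S. S \<subseteq> U \<Longrightarrow> f (mon S) = g (mon S)"
  shows "f = g"
proof (rule extensionalityI)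
  show "f \<in> extensional (carrier A)" "g \<in> extensional (carrier A)"
    using f g by (auto simp: dual_bimodule_def)
  fix x assume "x \<in> carrier A"
  then have "x \<in> k_span A (mon ` Pow U)" by (simp add: k_span_mon_all)
  then obtain T c where T: "finite T" "T \<subseteq> mon ` Pow U" and x: "x = (\<Oplus>b\<in>T. c b \<odot> b)"
    unfolding k_span_def by blast
  have closed: "b \<in> carrier A" if "b \<in> T" for b
    using that T(2) by auto
  have expand: "h x = (\<Sum>b\<in>T. c b * h b)" if h: "h \<in> dual" for h
  proof -
    have "h x = (\<Sum>b\<in>T. h (c b \<odot> b))"
      unfolding x
    proof (rule finsum_additive[OF abelian_group_axioms T(1)])
      show "(\<lambda>b. c b \<odot> b) \<in> T \<rightarrow> carrier A" using closed smult_closed by blast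
    qed (rule dual_add[OF h])
    also have "\<dots> = (\<Sum>b\<in>T. c b * h b)"
      by (intro sum.cong refl dual_smult[OF h] closed)
    finally show ?thesis .
  qed
  have "(\<Sum>b\<in>T. c b * f b) = (\<Sum>b\<in>T. c b * g b)"
    using T(2) eq by (intro sum.cong) auto
  then show "f x = g x" unfolding expand[OF f] expand[OF g] .
qed

text \<open>
  The map from \<open>A\<close> to its dual that sends \<open>x\<close> to the functional \<open>x \<rightharpoonup> \<lambda>\<close>, where \<open>\<lambda>\<close> is the top
  coordinate.
\<close>

definition frob_map :: "'a \<Rightarrow> 'a \<Rightarrow> 'k" where
  "frob_map x = (\<lambda>a\<in>carrier A. coord (a \<otimes> x) U)"

lemma frob_map_dual:
  assumes "x \<in> carrier A"
  shows "frob_map x \<in> dual"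
  using assms
  by (simp add: frob_map_def dual_bimodule_def l_distr coord_add coord_smult smult_closed
      smult_mult_left)

lemma frob_map_mon:
  assumes "x \<in> carrier A" "S \<subseteq> U"
  shows "frob_map x (mon S) = reorder q S (U - S) * coord x (U - S)"
proof -
  have "frob_map x (mon S)
      = (\<Sum>T\<in>Pow U. reorder q T (U - T) * coord (mon S) T * coord x (U - T))"
    using assms by (simp add: frob_map_def coord_mult)
  also have "\<dots> = (\<Sum>T\<in>Pow U. if S = T then reorder q S (U - S) * coord x (U - S) else 0)"
    by (intro sum.cong) auto
  also have "\<dots> = reorder q S (U - S) * coord x (U - S)"
    using finite_U assms by simp
  finally show ?thesis .
qed

lemma inj_on_frob_map: "inj_on frob_map (carrier A)"
proof (rule inj_onI)
  fix x y assume xy: "x \<in> carrier A" "y \<in> carrier A" and eq: "frob_map x = frob_map y"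
  show "x = y"
  proof (rule coord_inj[OF xy])
    fix S assume S: "S \<subseteq> U"
    then have "U - (U - S) = S" by blast
    then have "frob_map z (mon (U - S)) = reorder q (U - S) S * coord z S" if "z \<in> carrier A" for z
      using frob_map_mon[OF that, of "U - S"] by simp
    from this[OF xy(1)] this[OF xy(2)]
    have "reorder q (U - S) S * coord x S = reorder q (U - S) S * coord y S"
      using eq by metis
    moreover have "reorder q (U - S) S \<noteq> 0" using S by (intro reorder_nonzero) auto
    ultimately show "coord x S = coord y S" by simp
  qed
qed

lemma frob_map_surj:
  assumes "f \<in> dual"
  shows "frob_map (vec (\<lambda>S. f (mon (U - S)) / reorder q (U - S) S)) = f"
proof (rule dual_eqI)
  fix S assume S: "S \<subseteq> U"
  then have eq: "U - (U - S) = S" by blast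
  have nz: "reorder q S (U - S) \<noteq> 0" using S by (intro reorder_nonzero) auto
  show "frob_map (vec (\<lambda>S. f (mon (U - S)) / reorder q (U - S) S)) (mon S) = f (mon S)"
    unfolding frob_map_mon[OF vec_closed S] using nz by (simp add: eq)
qed (rule frob_map_dual vec_closed assms)+

lemma bij_frob_map: "bij_betw frob_map (carrier A) dual"
proof (rule bij_betw_imageI[OF inj_on_frob_map])
  show "frob_map ` carrier A = dual"
  proof (intro equalityI subsetI)
    fix f assume "f \<in> dual"
    then show "f \<in> frob_map ` carrier A"
      using frob_map_surj[of f] image_eqI[OF _ vec_closed, of f frob_map] by metis
  qed (use frob_map_dual in blast)
qed

lemma frob_map_left_module_iso: "frob_map \<in> left_module_iso A (regular_bimodule A) (dual_bimodule A)"
proof -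
  have "frob_map (x \<oplus> y) = (\<lambda>a\<in>carrier A. frob_map x a + frob_map y a)"
    if "x \<in> carrier A" "y \<in> carrier A" for x y
    using that by (intro ext) (simp add: frob_map_def r_distr coord_add)
  moreover have "frob_map (r \<otimes> x) = (\<lambda>a\<in>carrier A. frob_map x (a \<otimes> r))"
    if "r \<in> carrier A" "x \<in> carrier A" for r x
    using that by (intro ext) (simp add: frob_map_def m_assoc)
  ultimately show ?thesis
    unfolding left_module_iso_def using bij_frob_map
    by (simp add: regular_bimodule_def dual_bimodule_def)
qed

lemma frobenius: "frobenius_algebra A"
  unfolding frobenius_algebra_def using fin_dim frob_map_left_module_iso by blast

text \<open>
  The top coordinate is a trace as soon as each single generator can be moved to either side of
  the product of all generators with the same factor.
\<close>

lemma coord_top_commute: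
  assumes comm: "\<And>i. i \<in> U \<Longrightarrow> reorder q {i} U = reorder q U {i}"
    and x: "x \<in> carrier A" and y: "y \<in> carrier A"
  shows "coord (x \<otimes> y) U = coord (y \<otimes> x) U"
proof -
  have sym: "reorder q T (U - T) = reorder q (U - T) T" if T: "T \<subseteq> U" for T
  proof -
    have fin: "finite T" "finite (U - T)" using T finite_U finite_subset by blast+
    have un: "T \<union> (U - T) = U" using T by blast
    \<comment> \<open>By multiplicativity the hypothesis extends to \<open>T\<close>; factors within \<open>T\<close> cancel.\<close>
    have "reorder q T U = reorder q U T"
      using T comm by (subst reorder_prod_left, subst (2) reorder_prod_right)
        (auto intro!: prod.cong)
    moreover have "reorder q T U = reorder q T T * reorder q T (U - T)"
      using reorder_Un_right[OF fin Diff_disjoint, of q T] unfolding un .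
    moreover have "reorder q U T = reorder q T T * reorder q (U - T) T"
      using reorder_Un_left[OF fin Diff_disjoint, of q T] unfolding un .
    ultimately show ?thesis using reorder_nonzero[OF T T] by simp
  qed
  have "coord (x \<otimes> y) U = (\<Sum>T\<in>Pow U. reorder q T (U - T) * coord x T * coord y (U - T))"
    using x y by (simp add: coord_mult)
  also have "\<dots> = (\<Sum>T\<in>Pow U. reorder q T (U - T) * coord y T * coord x (U - T))"
    by (rule sum.reindex_bij_witness[of _ "\<lambda>T. U - T" "\<lambda>T. U - T"])
      (auto simp: double_diff sym)
  also have "\<dots> = coord (y \<otimes> x) U"
    using x y by (simp add: coord_mult)
  finally show ?thesis .
qed

lemma symmetric_if:
  assumes "\<And>i. i \<in> U \<Longrightarrow> reorder q {i} U = reorder q U {i}"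
  shows "symmetric_algebra A"
proof -
  have "frob_map (x \<otimes> r) = (\<lambda>a\<in>carrier A. frob_map x (r \<otimes> a))"
    if r: "r \<in> carrier A" and x: "x \<in> carrier A" for r x
  proof (rule ext)
    fix a
    have "coord (a \<otimes> (x \<otimes> r)) U = coord ((r \<otimes> a) \<otimes> x) U" if a: "a \<in> carrier A"
      using coord_top_commute[OF assms, of "a \<otimes> x" r] a r x by (simp add: m_assoc)
    then show "frob_map (x \<otimes> r) a = (\<lambda>a\<in>carrier A. frob_map x (r \<otimes> a)) a"
      using r x by (simp add: frob_map_def)
  qed
  then have "frob_map \<in> bimodule_iso A (regular_bimodule A) (dual_bimodule A)"
    using frob_map_left_module_iso
    by (simp add: bimodule_iso_def regular_bimodule_def dual_bimodule_def)
  then show ?thesis using fin_dim by (auto simp: symmetric_algebra_def)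
qed

lemma symmetric_only_if:
  assumes "symmetric_algebra A" and i: "i \<in> U"
  shows "reorder q {i} U = reorder q U {i}"
proof -
  obtain \<phi> where "\<phi> \<in> bimodule_iso A (regular_bimodule A) (dual_bimodule A)"
    using assms(1) by (auto simp: symmetric_algebra_def)
  then have bij: "bij_betw \<phi> (carrier A) dual"
    and left: "\<And>r x. r \<in> carrier A \<Longrightarrow> x \<in> carrier A \<Longrightarrow> \<phi> (r \<otimes> x) = (\<lambda>a\<in>carrier A. \<phi> x (a \<otimes> r))"
    and right: "\<And>r x. r \<in> carrier A \<Longrightarrow> x \<in> carrier A \<Longrightarrow> \<phi> (x \<otimes> r) = (\<lambda>a\<in>carrier A. \<phi> x (r \<otimes> a))"
    by (auto simp: bimodule_iso_def left_module_iso_def regular_bimodule_def dual_bimodule_def)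
  \<comment> \<open>Both \<open>r \<rightharpoonup> l\<close> and \<open>l \<leftharpoonup> r\<close> are \<open>\<phi> r\<close>, so \<open>l\<close> is a trace.\<close>
  define l where "l = \<phi> \<one>"
  have l: "l \<in> dual" using bij by (auto simp: l_def bij_betw_def)
  have phi: "\<phi> r = (\<lambda>a\<in>carrier A. l (a \<otimes> r))" if "r \<in> carrier A" for r
    using left[of r \<one>] that by (simp add: l_def)
  have trace: "l (a \<otimes> r) = l (r \<otimes> a)" if "a \<in> carrier A" "r \<in> carrier A" for a r
    using phi[of r] right[of r \<one>] that by (simp add: l_def fun_eq_iff) (metis restrict_apply')
  \<comment> \<open>Every \<open>a \<otimes> mon U\<close> is a scalar multiple of \<open>mon U\<close>, so \<open>l (mon U) = 0\<close> gives \<open>\<phi> (mon U) = 0\<close>.\<close>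
  have top: "l (mon U) \<noteq> 0"
  proof
    assume "l (mon U) = 0"
    then have "\<phi> (mon U) = (\<lambda>a\<in>carrier A. 0)"
      by (auto simp: phi fun_eq_iff mult_mon_top dual_smult[OF l])
    moreover have "l \<zero> = 0"
      using dual_add[OF l, of \<zero> \<zero>] by (metis add_cancel_right_right l_zero zero_closed)
    then have "\<phi> \<zero> = (\<lambda>a\<in>carrier A. 0)"
      by (auto simp: phi fun_eq_iff)
    ultimately have "mon U = \<zero>"
      using inj_onD[OF bij_betw_imp_inj_on[OF bij], of "mon U" \<zero>] by simp
    then show False using coord_mon[of U U] coord_zero[of U] by simp
  qed
  define V where "V = U - {i}"
  have V: "V \<subseteq> U" "{i} \<inter> V = {}" "V \<inter> {i} = {}" "{i} \<union> V = U" "V \<union> {i} = U" "{i} \<subseteq> U"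
    using i by (auto simp: V_def)
  have fin: "finite V" using finite_U by (simp add: V_def)
  have "reorder q {i} V * l (mon U) = reorder q V {i} * l (mon U)"
    using trace[of "mon {i}" "mon V"] V by (simp add: mon_mult dual_smult[OF l])
  with top have "reorder q {i} V = reorder q V {i}" by simp
  moreover have "reorder q U {i} = reorder q {i} {i} * reorder q V {i}"
    using reorder_Un_left[OF _ fin V(2), of q "{i}"] unfolding V(4) by simp
  moreover have "reorder q {i} U = reorder q {i} {i} * reorder q {i} V"
    using reorder_Un_right[OF _ fin V(2), of q "{i}"] unfolding V(4) by simp
  ultimately show ?thesis by simp
qed

end

section \<open>Gradings\<close>

text \<open>
  A grading by an arbitrary group for which the basis elements are homogeneous. The components
  are prescribed on the carrier of the group only.
\<close>

locale graded_quantum_exterior = quantum_exterior A U q coord + G: group G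
  for A :: "('k::field, 'a) module" (structure) and U q coord and G :: "('g, 'b) monoid_scheme" +
  fixes deg :: "nat set \<Rightarrow> 'g" and C :: "'g \<Rightarrow> 'a set"
  assumes deg_closed: "S \<subseteq> U \<Longrightarrow> deg S \<in> carrier G"
    and deg_empty: "deg {} = \<one>\<^bsub>G\<^esub>"
    and deg_Un: "S \<subseteq> U \<Longrightarrow> T \<subseteq> U \<Longrightarrow> S \<inter> T = {} \<Longrightarrow> deg (S \<union> T) = deg S \<otimes>\<^bsub>G\<^esub> deg T"
    and component: "g \<in> carrier G \<Longrightarrow> C g = k_span A {mon S |S. S \<subseteq> U \<and> deg S = g}"
begin

lemma mem_component:
  assumes "g \<in> carrier G"
  shows "x \<in> C g \<longleftrightarrow> x \<in> carrier A \<and> (\<forall>S\<subseteq>U. coord x S \<noteq> 0 \<longrightarrow> deg S = g)"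
proof -
  have "{mon S |S. S \<subseteq> U \<and> deg S = g} = mon ` {S. S \<subseteq> U \<and> deg S = g}" by auto
  moreover have "{S. S \<subseteq> U \<and> deg S = g} \<subseteq> Pow U" by auto
  ultimately show ?thesis using assms by (simp add: component k_span_mon)
qed

lemma component_subspace:
  assumes g: "g \<in> carrier G"
  shows "k_subspace A (C g)"
proof -
  have "x \<oplus> y \<in> C g" if "x \<in> C g" "y \<in> C g" for x y
    using that unfolding mem_component[OF g] by (metis add.m_closed add_0 coord_add)
  moreover have "c \<odot> x \<in> C g" if "x \<in> C g" for c x
    using that unfolding mem_component[OF g] by (auto simp: coord_smult smult_closed)
  moreover have "C g \<subseteq> carrier A" "\<zero> \<in> C g"
    by (auto simp: mem_component[OF g])
  ultimately show ?thesis
    unfolding k_subspace_def by blast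
qed

lemma component_mult:
  assumes g: "g \<in> carrier G" and h: "h \<in> carrier G" and x: "x \<in> C g" and y: "y \<in> C h"
  shows "x \<otimes> y \<in> C (g \<otimes>\<^bsub>G\<^esub> h)"
proof -
  have xy: "x \<in> carrier A" "y \<in> carrier A" using g h x y by (auto simp: mem_component)
  have "deg S = g \<otimes>\<^bsub>G\<^esub> h" if S: "S \<subseteq> U" and nz: "coord (x \<otimes> y) S \<noteq> 0" for S
  proof -
    obtain T where T: "T \<in> Pow S" "reorder q T (S - T) * coord x T * coord y (S - T) \<noteq> 0"
      using nz unfolding coord_mult[OF xy S] by (rule sum.not_neutral_contains_not_neutral)
    then have "T \<subseteq> U" "S - T \<subseteq> U" "T \<union> (S - T) = S" using S by auto
    moreover have "deg T = g" "deg (S - T) = h"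
      using T g h x y \<open>T \<subseteq> U\<close> \<open>S - T \<subseteq> U\<close> by (auto simp: mem_component)
    ultimately show ?thesis using deg_Un[of T "S - T"] by simp
  qed
  then show ?thesis using xy g h by (simp add: mem_component)
qed

text \<open>
  A family of homogeneous elements sums up to \<open>x\<close> if and only if it is the obvious one; this
  gives both the existence and the uniqueness of the homogeneous decomposition.
\<close>

lemma homogeneous_decomposition_iff:
  assumes f: "f \<in> (\<Pi>\<^sub>E g\<in>carrier G. C g)" and x: "x \<in> carrier A"
  shows "finite {g \<in> carrier G. f g \<noteq> \<zero>} \<and> x = (\<Oplus>g\<in>{g \<in> carrier G. f g \<noteq> \<zero>}. f g) \<longleftrightarrow>
    (\<forall>g\<in>carrier G. \<forall>S\<subseteq>U. coord (f g) S = (if deg S = g then coord x S else 0))"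
    (is "?L \<longleftrightarrow> ?R")
proof -
  let ?I = "{g \<in> carrier G. f g \<noteq> \<zero>}"
  have fC: "f g \<in> C g" if "g \<in> carrier G" for g using f that by auto
  then have closed: "f g \<in> carrier A" if "g \<in> carrier G" for g
    using that by (auto simp: mem_component)
  have off: "coord (f g) S = 0" if "g \<in> carrier G" "S \<subseteq> U" "deg S \<noteq> g" for g S
    using fC that by (auto simp: mem_component)
  have fin: "finite ?I"
  proof (rule finite_subset)
    show "?I \<subseteq> deg ` Pow U"
    proof (rule subsetI, rule ccontr)
      fix g assume g: "g \<in> ?I" "g \<notin> deg ` Pow U"
      then have "deg S \<noteq> g" if "S \<subseteq> U" for S using that by blast
      with g have "f g = \<zero>" by (intro coord_inj) (simp_all add: closed off)
      with g show False by simp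
    qed
  qed (simp add: finite_U)
  have sum: "coord (\<Oplus>g\<in>?I. f g) S = coord (f (deg S)) S" if S: "S \<subseteq> U" for S
  proof -
    have "coord (\<Oplus>g\<in>?I. f g) S = (\<Sum>g\<in>?I. coord (f g) S)"
      using fin S closed by (intro coord_finsum) auto
    also have "\<dots> = (\<Sum>g\<in>?I. if deg S = g then coord (f (deg S)) S else 0)"
      using S by (intro sum.cong) (auto simp: off)
    also have "\<dots> = coord (f (deg S)) S"
      using fin S deg_closed[OF S] by auto
    finally show ?thesis .
  qed
  have "?L \<longleftrightarrow> (\<forall>S\<subseteq>U. coord x S = coord (f (deg S)) S)"
  proof
    assume "\<forall>S\<subseteq>U. coord x S = coord (f (deg S)) S"
    then have "x = (\<Oplus>g\<in>?I. f g)"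
      using x closed by (intro coord_inj) (auto simp: sum intro!: finsum_closed)
    with fin show ?L by blast
  qed (use sum in auto)
  also have "\<dots> \<longleftrightarrow> ?R" using off deg_closed by auto
  finally show ?thesis .
qed

lemma graded: "graded_algebra G A C"
proof -
  have "\<exists>!f. f \<in> (\<Pi>\<^sub>E g\<in>carrier G. C g) \<and> finite {g \<in> carrier G. f g \<noteq> \<zero>} \<and>
      x = (\<Oplus>g\<in>{g \<in> carrier G. f g \<noteq> \<zero>}. f g)" if x: "x \<in> carrier A" for x
  proof (rule ex1I)
    let ?f = "\<lambda>g\<in>carrier G. vec (\<lambda>S. if deg S = g then coord x S else 0)"
    have f_mem: "?f \<in> (\<Pi>\<^sub>E g\<in>carrier G. C g)" by (auto simp: mem_component)
    have "\<forall>g\<in>carrier G. \<forall>S\<subseteq>U. coord (?f g) S = (if deg S = g then coord x S else 0)"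
      by simp
    then show "?f \<in> (\<Pi>\<^sub>E g\<in>carrier G. C g) \<and> finite {g \<in> carrier G. ?f g \<noteq> \<zero>} \<and>
      x = (\<Oplus>g\<in>{g \<in> carrier G. ?f g \<noteq> \<zero>}. ?f g)"
      using f_mem homogeneous_decomposition_iff[OF f_mem x] by blast
    fix f assume "f \<in> (\<Pi>\<^sub>E g\<in>carrier G. C g) \<and> finite {g \<in> carrier G. f g \<noteq> \<zero>} \<and>
      x = (\<Oplus>g\<in>{g \<in> carrier G. f g \<noteq> \<zero>}. f g)"
    then have f: "f \<in> (\<Pi>\<^sub>E g\<in>carrier G. C g)"
      and eq: "\<forall>g\<in>carrier G. \<forall>S\<subseteq>U. coord (f g) S = (if deg S = g then coord x S else 0)"
      using homogeneous_decomposition_iff[OF _ x, of f] by blast+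
    show "f = ?f"
    proof (rule PiE_ext[OF f])
      show "?f \<in> (\<Pi>\<^sub>E g\<in>carrier G. C g)" by (rule f_mem)
      fix g assume g: "g \<in> carrier G"
      then have "f g \<in> carrier A" using f mem_component by blast
      then show "f g = ?f g" using g eq by (auto intro!: coord_inj)
    qed
  qed
  then show ?thesis
    using component_subspace component_mult k_algebra_axioms G.group_axioms
    by (simp add: graded_algebra_def)
qed

lemma graded_frobenius_top: "graded_frobenius G A C (deg U)"
proof -
  define \<phi> where "\<phi> = (\<lambda>f. vec (\<lambda>S. f (mon (U - S)) / reorder q (U - S) S))"
  have frob_map_phi: "frob_map (\<phi> f) = f" if "f \<in> dual" for f
    using frob_map_surj[OF that] by (simp add: \<phi>_def)
  have phi_frob_map: "\<phi> (frob_map x) = x" if "x \<in> carrier A" for x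
    using inj_onD[OF inj_on_frob_map frob_map_phi[OF frob_map_dual[OF that]]] that
    by (simp add: \<phi>_def)
  have phi_closed: "\<phi> f \<in> carrier A" for f by (simp add: \<phi>_def)
  have "bij_betw \<phi> dual (carrier A)"
    by (rule bij_betw_byWitness[of _ frob_map])
      (auto simp: frob_map_phi phi_frob_map phi_closed frob_map_dual)
  moreover have "\<phi> (madd (dual_bimodule A) f g) = \<phi> f \<oplus> \<phi> g" if "f \<in> dual" "g \<in> dual" for f g
  proof -
    have "frob_map (\<phi> f \<oplus> \<phi> g) = madd (dual_bimodule A) (frob_map (\<phi> f)) (frob_map (\<phi> g))"
      using frob_map_left_module_iso phi_closed by (simp add: left_module_iso_def regular_bimodule_def)
    then show ?thesis using that phi_frob_map[of "\<phi> f \<oplus> \<phi> g"] by (simp add: frob_map_phi phi_closed)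
  qed
  moreover have "\<phi> (lact (dual_bimodule A) r f) = r \<otimes> \<phi> f" if "r \<in> carrier A" "f \<in> dual" for r f
  proof -
    have "frob_map (r \<otimes> \<phi> f) = lact (dual_bimodule A) r (frob_map (\<phi> f))"
      using frob_map_left_module_iso phi_closed that
      by (simp add: left_module_iso_def regular_bimodule_def)
    then show ?thesis using that phi_frob_map[of "r \<otimes> \<phi> f"] by (simp add: frob_map_phi phi_closed)
  qed
  ultimately have iso: "\<phi> \<in> left_module_iso A (dual_bimodule A) (regular_bimodule A)"
    by (simp add: left_module_iso_def regular_bimodule_def)
  have shift: "\<phi> f \<in> shift_component G C (deg U) g"
    if g: "g \<in> carrier G" and f: "f \<in> dual_component G A C g" for g f
  proof -
    have "deg S = g \<otimes>\<^bsub>G\<^esub> deg U" if S: "S \<subseteq> U" and nz: "coord (\<phi> f) S \<noteq> 0" for S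
    proof -
      \<comment> \<open>The coordinate of \<open>\<phi> f\<close> at \<open>S\<close> comes from the value of \<open>f\<close> at the complement of \<open>S\<close>.\<close>
      have "f (mon (U - S)) \<noteq> 0" using S nz by (auto simp: \<phi>_def)
      moreover have "mon (U - S) \<in> C (deg (U - S))"
        by (simp add: mem_component deg_closed)
      ultimately have "deg (U - S) = inv\<^bsub>G\<^esub> g"
        using f deg_closed[of "U - S"] by (auto simp: dual_component_def)
      moreover have "(U - S) \<inter> S = {}" "U - S \<union> S = U" using S by blast+
      then have "deg U = deg (U - S) \<otimes>\<^bsub>G\<^esub> deg S"
        using deg_Un[of "U - S" S] S by simp
      ultimately show ?thesis
        using g deg_closed[OF S] by (metis G.inv_closed G.l_one G.m_assoc G.r_inv)
    qed
    then show ?thesis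
      using g by (simp add: shift_component_def mem_component deg_closed phi_closed)
  qed
  show ?thesis
    unfolding graded_frobenius_def
    by (intro conjI bexI[OF _ iso] ballI image_subsetI fin_dim graded shift)
qed

lemma graded_frobenius_unique:
  assumes s: "s \<in> carrier G" and frob: "graded_frobenius G A C s"
  shows "s = deg U"
proof -
  obtain \<phi> where iso: "\<phi> \<in> left_module_iso A (dual_bimodule A) (regular_bimodule A)"
    and hom: "\<And>g. g \<in> carrier G \<Longrightarrow> \<phi> ` dual_component G A C g \<subseteq> shift_component G C s g"
    using frob by (auto simp: graded_frobenius_def)
  have degU: "deg U \<in> carrier G" by (simp add: deg_closed)
  \<comment> \<open>The top coordinate functional is \<open>frob_map \<one>\<close>.\<close>
  have "frob_map \<one> \<in> dual_component G A C (inv\<^bsub>G\<^esub> deg U)"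
    using frob_map_dual[OF one_closed] degU
    by (auto simp: dual_component_def frob_map_def mem_component)
  then have "\<phi> (frob_map \<one>) \<in> C (inv\<^bsub>G\<^esub> deg U \<otimes>\<^bsub>G\<^esub> s)"
    using hom[of "inv\<^bsub>G\<^esub> deg U"] degU by (auto simp: shift_component_def)
  obtain f where f: "f \<in> dual" "\<phi> f = \<one>"
    using iso one_closed by (force simp: left_module_iso_def regular_bimodule_def bij_betw_def)
  obtain a where a: "a \<in> carrier A" "frob_map a = f"
    using f(1) by (metis bij_frob_map bij_betw_imp_surj_on imageE)
  have "frob_map (a \<otimes> \<one>) = lact (dual_bimodule A) a (frob_map \<one>)"
    using frob_map_left_module_iso a(1) one_closed
    by (simp add: left_module_iso_def regular_bimodule_def del: r_one)
  then have "\<phi> f = \<phi> (lact (dual_bimodule A) a (frob_map \<one>))"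
    using a by simp
  also have "\<dots> = a \<otimes> \<phi> (frob_map \<one>)"
    using iso a frob_map_dual[OF one_closed] by (simp add: left_module_iso_def regular_bimodule_def)
  finally have one: "a \<otimes> \<phi> (frob_map \<one>) = \<one>" using f by simp
  have closed: "\<phi> (frob_map \<one>) \<in> carrier A"
    using iso frob_map_dual[OF one_closed]
    by (auto simp: left_module_iso_def regular_bimodule_def bij_betw_def)
  have "coord \<one> {} = coord a {} * coord (\<phi> (frob_map \<one>)) {}"
    using coord_mult[OF a(1) closed, of "{}"] unfolding one by simp
  then have "coord (\<phi> (frob_map \<one>)) {} \<noteq> 0" by (auto simp: coord_one)
  with \<open>\<phi> (frob_map \<one>) \<in> C _\<close> have "\<one>\<^bsub>G\<^esub> = inv\<^bsub>G\<^esub> deg U \<otimes>\<^bsub>G\<^esub> s"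
    using degU s by (auto simp: mem_component deg_empty)
  then show ?thesis using degU s by (metis G.inv_closed G.l_one G.m_assoc G.r_inv G.r_one)
qed

end

section \<open>Coordinates on the free algebra\<close>

text \<open>
  Additive induction over the finitely supported functions with support in \<open>W\<close>.
\<close>

lemma poly_mapping_keys_induct [consumes 1, case_names zero single add]:
  fixes p :: "'a \<Rightarrow>\<^sub>0 'b::comm_monoid_add"
  assumes "Poly_Mapping.keys p \<subseteq> W"
    and zero: "P 0"
    and single: "\<And>w c. w \<in> W \<Longrightarrow> P (Poly_Mapping.single w c)"
    and add: "\<And>p r. Poly_Mapping.keys p \<subseteq> W \<Longrightarrow> Poly_Mapping.keys r \<subseteq> W \<Longrightarrow> P p \<Longrightarrow> P r \<Longrightarrow> P (p + r)"
  shows "P p"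
proof -
  have "P (\<Sum>w\<in>V. Poly_Mapping.single w (Poly_Mapping.lookup p w)) \<and>
      Poly_Mapping.keys (\<Sum>w\<in>V. Poly_Mapping.single w (Poly_Mapping.lookup p w)) \<subseteq> W"
    if "finite V" "V \<subseteq> W" for V
    using that
  proof (induction V)
    case (insert v V)
    let ?s = "Poly_Mapping.single v (Poly_Mapping.lookup p v)"
    let ?r = "\<Sum>w\<in>V. Poly_Mapping.single w (Poly_Mapping.lookup p w)"
    have v: "v \<in> W" and r: "P ?r" "Poly_Mapping.keys ?r \<subseteq> W" using insert by auto
    have s: "Poly_Mapping.keys ?s \<subseteq> W" using v by simp
    have "Poly_Mapping.keys (?s + ?r) \<subseteq> W"
      using Poly_Mapping.keys_add[of ?s ?r] s r(2) by blast
    then show ?case using add[OF s r(2) single[OF v] r(1)] insert.hyps by simp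
  qed (simp add: zero)
  then have "P (\<Sum>w\<in>Poly_Mapping.keys p. Poly_Mapping.single w (Poly_Mapping.lookup p w))"
    using assms(1) by simp
  also have "(\<Sum>w\<in>Poly_Mapping.keys p. Poly_Mapping.single w (Poly_Mapping.lookup p w)) = p"
    by (rule poly_mapping_eqI) (auto simp: lookup_sum lookup_single when_def in_keys_iff)
  finally show ?thesis .
qed

text \<open>
  The coefficient at \<open>S\<close> of the element that straightening makes of \<open>p\<close>. Only finitely many words
  have the letters \<open>S\<close> without repetition; for infinite \<open>S\<close> there is none.
\<close>

definition word_coord :: "(nat \<Rightarrow> nat \<Rightarrow> 'k::field) \<Rightarrow> (nat list \<Rightarrow>\<^sub>0 'k) \<Rightarrow> nat set \<Rightarrow> 'k" where
  "word_coord q p S =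
     (\<Sum>w | distinct w \<and> set w = S. Poly_Mapping.lookup p w * sort_factor q w)"

lemma finite_distinct_set_eq: "finite {w. distinct w \<and> set w = S}"
proof (cases "finite S")
  case True
  show ?thesis
    by (rule finite_subset[OF _ finite_lists_length_le[OF True, of "card S"]])
      (auto simp: distinct_card)
next
  case False
  then have "{w. distinct w \<and> set w = S} = {}" by auto
  then show ?thesis by (metis finite.emptyI)
qed

lemma word_coord_zero [simp]: "word_coord q 0 S = 0"
  by (simp add: word_coord_def)

lemma word_coord_add: "word_coord q (p + r) S = word_coord q p S + word_coord q r S"
  by (simp add: word_coord_def lookup_add distrib_right sum.distrib)

lemma word_coord_diff: "word_coord q (p - r) S = word_coord q p S - word_coord q r S"
  by (simp add: word_coord_def lookup_minus left_diff_distrib sum_subtractf)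

lemma word_coord_sum: "word_coord q (\<Sum>i\<in>I. f i) S = (\<Sum>i\<in>I. word_coord q (f i) S)"
  by (induction I rule: infinite_finite_induct) (simp_all add: word_coord_add)

lemma word_coord_scale: "word_coord q (Poly_Mapping.map ((*) c) p) S = c * word_coord q p S"
proof -
  have "Poly_Mapping.lookup (Poly_Mapping.map ((*) c) p) w = c * Poly_Mapping.lookup p w" for w
    by (simp add: Poly_Mapping.map.rep_eq when_def)
  then show ?thesis by (simp add: word_coord_def sum_distrib_left mult.assoc)
qed

lemma word_coord_single:
  "word_coord q (Poly_Mapping.single w c) S =
     (if distinct w \<and> set w = S then c * sort_factor q w else 0)"
proof -
  have "word_coord q (Poly_Mapping.single w c) S =
      (\<Sum>v | distinct v \<and> set v = S. if w = v then c * sort_factor q w else 0)"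
    unfolding word_coord_def by (intro sum.cong) (auto simp: lookup_single when_def)
  also have "\<dots> = (if w \<in> {v. distinct v \<and> set v = S} then c * sort_factor q w else 0)"
    by (rule sum.delta'[OF finite_distinct_set_eq])
  finally show ?thesis by simp
qed

lemma word_coord_one: "word_coord q 1 S = (if S = {} then 1 else 0)"
  using word_coord_single[of q "[]" 1 S]
  by (simp add: single_one[symmetric] zero_list_def del: single_one)

text \<open>
  The product rule of the quantum exterior algebra already holds on the free algebra. It makes
  the common kernel of the coordinates an ideal.
\<close>

lemma word_coord_mult:
  assumes S: "finite S"
  shows "word_coord q (p * r) S =
    (\<Sum>T\<in>Pow S. reorder q T (S - T) * word_coord q p T * word_coord q r (S - T))"
proof -
  have single: "word_coord q (Poly_Mapping.single u a * Poly_Mapping.single v b) S =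
    (\<Sum>T\<in>Pow S. reorder q T (S - T) * word_coord q (Poly_Mapping.single u a) T *
        word_coord q (Poly_Mapping.single v b) (S - T))" for u v a b
  proof -
    let ?c = "if distinct u \<and> distinct v \<and> set v = S - set u
      then reorder q (set u) (set v) * (a * sort_factor q u) * (b * sort_factor q v) else 0"
    have "(\<Sum>T\<in>Pow S. reorder q T (S - T) * word_coord q (Poly_Mapping.single u a) T *
        word_coord q (Poly_Mapping.single v b) (S - T)) =
      (\<Sum>T\<in>Pow S. if set u = T then ?c else 0)"
      by (intro sum.cong refl) (auto simp: word_coord_single)
    also have "\<dots> = (if set u \<subseteq> S then ?c else 0)"
      using S by simp
    also have "\<dots> = (if distinct (u @ v) \<and> set (u @ v) = S then a * b * sort_factor q (u @ v) else 0)"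
    proof -
      have "set u \<subseteq> S \<and> distinct u \<and> distinct v \<and> set v = S - set u \<longleftrightarrow>
          distinct (u @ v) \<and> set (u @ v) = S"
        by auto
      then show ?thesis by (auto simp: sort_factor_append)
    qed
    finally show ?thesis
      by (simp add: mult_single word_coord_single plus_list_def)
  qed
  have left: "word_coord q (Poly_Mapping.single u a * r) S =
    (\<Sum>T\<in>Pow S. reorder q T (S - T) * word_coord q (Poly_Mapping.single u a) T *
        word_coord q r (S - T))" for u a
    by (rule poly_mapping_keys_induct[of r UNIV])
      (simp_all add: single word_coord_add distrib_left sum.distrib)
  show ?thesis
    by (rule poly_mapping_keys_induct[of p UNIV])
      (simp_all add: left word_coord_add distrib_left distrib_right sum.distrib)
qed

lemma k_algebra_free_algebra: "k_algebra (free_algebra n :: ('k::field, nat list \<Rightarrow>\<^sub>0 'k) module)"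
proof -
  let ?F = "free_algebra n :: ('k, nat list \<Rightarrow>\<^sub>0 'k) module"
  have add: "p + r \<in> carrier ?F" if "p \<in> carrier ?F" "r \<in> carrier ?F" for p r
    using that Poly_Mapping.keys_add[of p r] by (auto simp: free_algebra_def)
  have mult: "p * r \<in> carrier ?F" if "p \<in> carrier ?F" "r \<in> carrier ?F" for p r
  proof -
    have "set w \<subseteq> {1..n}" if w: "w \<in> Poly_Mapping.keys (p * r)" for w
    proof -
      obtain u v where "w = u + v" "u \<in> Poly_Mapping.keys p" "v \<in> Poly_Mapping.keys r"
        using keys_mult[of p r] w by blast
      then show ?thesis
        using \<open>p \<in> carrier ?F\<close> \<open>r \<in> carrier ?F\<close> by (auto simp: free_algebra_def plus_list_def)
    qed
    then show ?thesis by (simp add: free_algebra_def)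
  qed
  have one: "1 \<in> carrier ?F" by (simp add: free_algebra_def zero_list_def)
  have neg: "- p \<in> carrier ?F" if "p \<in> carrier ?F" for p
    using that by (simp add: free_algebra_def in_keys_iff)
  have scale: "Poly_Mapping.map ((*) c) p \<in> carrier ?F" if "p \<in> carrier ?F" for c p
    using that by (auto simp: free_algebra_def in_keys_iff Poly_Mapping.map.rep_eq when_def)
  have comm: "p * Poly_Mapping.single 0 c = Poly_Mapping.single 0 c * p" for p :: "nat list \<Rightarrow>\<^sub>0 'k" and c
    by (rule poly_mapping_keys_induct[of p UNIV])
      (simp_all add: mult_single distrib_left distrib_right mult.commute)
  have ops: "p \<oplus>\<^bsub>?F\<^esub> r = p + r" "p \<otimes>\<^bsub>?F\<^esub> r = p * r" "\<zero>\<^bsub>?F\<^esub> = 0" "\<one>\<^bsub>?F\<^esub> = 1"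
      "c \<odot>\<^bsub>?F\<^esub> p = Poly_Mapping.single 0 c * p" for p r c
    by (simp_all add: free_algebra_def mult_map_scale_conv_mult)
  have zero: "0 \<in> carrier ?F" by (simp add: free_algebra_def)
  have ring: "ring ?F"
  proof (intro ringI abelian_groupI monoidI)
    fix p assume "p \<in> carrier ?F"
    then show "\<exists>r\<in>carrier ?F. r \<oplus>\<^bsub>?F\<^esub> p = \<zero>\<^bsub>?F\<^esub>"
      by (intro bexI[of _ "- p"] neg) (simp_all add: ops)
  qed (simp_all add: ops add mult one zero algebra_simps)
  show ?thesis
  proof (rule k_algebra.intro[OF ring], unfold_locales)
    fix p c assume "p \<in> carrier ?F"
    then show "c \<odot>\<^bsub>?F\<^esub> p \<in> carrier ?F"
      using scale by (simp add: ops mult_map_scale_conv_mult)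
  next
    fix p r :: "nat list \<Rightarrow>\<^sub>0 'k" and c
    have "p * (Poly_Mapping.single 0 c * r) = p * Poly_Mapping.single 0 c * r"
      by (simp add: mult.assoc)
    then show "p \<otimes>\<^bsub>?F\<^esub> (c \<odot>\<^bsub>?F\<^esub> r) = c \<odot>\<^bsub>?F\<^esub> (p \<otimes>\<^bsub>?F\<^esub> r)"
      by (simp add: ops comm mult.assoc)
  qed (simp_all add: ops single_add distrib_left distrib_right mult.assoc[symmetric] mult_single)
qed

lemma free_algebra_simps [simp]:
  fixes p r :: "nat list \<Rightarrow>\<^sub>0 'k::field"
  shows "p \<oplus>\<^bsub>free_algebra n\<^esub> r = p + r" "p \<otimes>\<^bsub>free_algebra n\<^esub> r = p * r"
    "\<zero>\<^bsub>free_algebra n\<^esub> = (0 :: nat list \<Rightarrow>\<^sub>0 'k)" "\<one>\<^bsub>free_algebra n\<^esub> = (1 :: nat list \<Rightarrow>\<^sub>0 'k)"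
    "c \<odot>\<^bsub>free_algebra n\<^esub> p = Poly_Mapping.map ((*) c) p"
  by (simp_all add: free_algebra_def)

lemma single_mem_free_algebra: "set w \<subseteq> {1..n} \<Longrightarrow> Poly_Mapping.single w c \<in> carrier (free_algebra n)"
  by (auto simp: free_algebra_def)

lemma minus_free_algebra:
  fixes p r :: "nat list \<Rightarrow>\<^sub>0 'k::field"
  assumes p: "p \<in> carrier (free_algebra n)" and r: "r \<in> carrier (free_algebra n)"
  shows "p \<ominus>\<^bsub>free_algebra n\<^esub> r = p - r"
proof -
  interpret k_algebra "free_algebra n :: ('k, nat list \<Rightarrow>\<^sub>0 'k) module"
    by (rule k_algebra_free_algebra)
  have "(p \<ominus>\<^bsub>free_algebra n\<^esub> r) \<oplus>\<^bsub>free_algebra n\<^esub> r = p"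
    using p r by (simp add: minus_eq l_neg a_assoc del: free_algebra_simps)
  then have "(p \<ominus>\<^bsub>free_algebra n\<^esub> r) + r = p" by simp
  then show ?thesis by (simp add: eq_diff_eq)
qed

text \<open>
  The common kernel of the coordinates.
\<close>

definition coord_ideal :: "nat \<Rightarrow> (nat \<Rightarrow> nat \<Rightarrow> 'k::field) \<Rightarrow> (nat list \<Rightarrow>\<^sub>0 'k) set" where
  "coord_ideal n q = {p \<in> carrier (free_algebra n). \<forall>S\<subseteq>{1..n}. word_coord q p S = 0}"

lemma ideal_coord_ideal:
  fixes q :: "nat \<Rightarrow> nat \<Rightarrow> 'k::field"
  shows "ideal (coord_ideal n q) (free_algebra n)"
proof -
  interpret k_algebra "free_algebra n :: ('k, nat list \<Rightarrow>\<^sub>0 'k) module"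
    by (rule k_algebra_free_algebra)
  have mult: "word_coord q (p * r) S = 0"
    if S: "S \<subseteq> {1..n}" and "p \<in> coord_ideal n q \<or> r \<in> coord_ideal n q" for p r S
  proof -
    have "finite S" using S finite_subset by blast
    moreover have "word_coord q p T = 0 \<or> word_coord q r (S - T) = 0" if "T \<in> Pow S" for T
    proof -
      have "T \<subseteq> {1..n}" "S - T \<subseteq> {1..n}" using that S by auto
      then show ?thesis
        using \<open>p \<in> coord_ideal n q \<or> r \<in> coord_ideal n q\<close> by (auto simp: coord_ideal_def)
    qed
    ultimately show ?thesis
      unfolding word_coord_mult[OF \<open>finite S\<close>] by (intro sum.neutral) auto
  qed
  show ?thesis
  proof (rule idealI[OF ring_axioms])
    show "subgroup (coord_ideal n q) (add_monoid (free_algebra n))"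
    proof (rule add.subgroupI)
      show "coord_ideal n q \<subseteq> carrier (free_algebra n)" by (auto simp: coord_ideal_def)
      show "coord_ideal n q \<noteq> {}"
        using zero_closed by (auto simp: coord_ideal_def intro!: exI[of _ 0])
    next
      fix p assume p: "p \<in> coord_ideal n q"
      then have closed: "p \<in> carrier (free_algebra n)" by (simp add: coord_ideal_def)
      then have "p + \<ominus>\<^bsub>free_algebra n\<^esub> p = 0" using r_neg by simp
      then have "word_coord q (\<ominus>\<^bsub>free_algebra n\<^esub> p) S = - word_coord q p S" for S
        by (metis add_eq_0_iff word_coord_add word_coord_zero)
      then show "\<ominus>\<^bsub>free_algebra n\<^esub> p \<in> coord_ideal n q"
        using p a_inv_closed[OF closed] by (simp add: coord_ideal_def)
    next
      fix p r assume "p \<in> coord_ideal n q" "r \<in> coord_ideal n q"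
      then show "p \<oplus>\<^bsub>free_algebra n\<^esub> r \<in> coord_ideal n q"
        using a_closed by (auto simp: coord_ideal_def word_coord_add simp del: a_closed)
    qed
  next
    fix p r :: "nat list \<Rightarrow>\<^sub>0 'k" assume pr: "p \<in> coord_ideal n q" "r \<in> carrier (free_algebra n)"
    then have "p \<in> carrier (free_algebra n)" by (simp add: coord_ideal_def)
    then have "r * p \<in> carrier (free_algebra n)" "p * r \<in> carrier (free_algebra n)"
      using pr m_closed by auto
    then show "r \<otimes>\<^bsub>free_algebra n\<^esub> p \<in> coord_ideal n q" "p \<otimes>\<^bsub>free_algebra n\<^esub> r \<in> coord_ideal n q"
      using pr mult by (simp_all add: coord_ideal_def)
  qed
qed

section \<open>Straightening of words in the quotient\<close>

text \<open>
  The class in \<open>A(q)\<close> of an element of the free algebra.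
\<close>

definition Aq_class ::
    "nat \<Rightarrow> (nat \<Rightarrow> nat \<Rightarrow> 'k::field) \<Rightarrow> (nat list \<Rightarrow>\<^sub>0 'k) \<Rightarrow> (nat list \<Rightarrow>\<^sub>0 'k) set set"
    where
  "Aq_class n q p =
     squares_ideal n q +>\<^bsub>quantum_poly_algebra n q\<^esub> (quantum_ideal n q +>\<^bsub>free_algebra n\<^esub> p)"

text \<open>
  The combination of sorted words with the same coordinates as \<open>p\<close>.
\<close>

definition normal_form ::
    "nat \<Rightarrow> (nat \<Rightarrow> nat \<Rightarrow> 'k::field) \<Rightarrow> (nat list \<Rightarrow>\<^sub>0 'k) \<Rightarrow> (nat list \<Rightarrow>\<^sub>0 'k)" where
  "normal_form n q p =
     (\<Sum>S\<in>Pow {1..n}. Poly_Mapping.single (sorted_list_of_set S) (word_coord q p S))"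

context
  fixes n :: nat and q :: "nat \<Rightarrow> nat \<Rightarrow> 'k::field"
begin

interpretation F: k_algebra "free_algebra n :: ('k, nat list \<Rightarrow>\<^sub>0 'k) module"
  by (rule k_algebra_free_algebra)

abbreviation (input) "F \<equiv> free_algebra n :: ('k, nat list \<Rightarrow>\<^sub>0 'k) module"
abbreviation (input) "P \<equiv> quantum_poly_algebra n q"
abbreviation (input) "J \<equiv> quantum_ideal n q"
abbreviation (input) "\<pi> \<equiv> Aq_class n q"

lemma free_gen_closed: "i \<in> {1..n} \<Longrightarrow> free_gen i \<in> carrier F"
  unfolding free_gen_def by (rule single_mem_free_algebra) simp

lemma scale_closed: "p \<in> carrier F \<Longrightarrow> Poly_Mapping.map ((*) c) p \<in> carrier F"
  using F.smult_closed[of p c] by simp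

lemma quantum_relation_closed:
  assumes "1 \<le> i" "i < j" "j \<le> n"
  shows "free_gen j * free_gen i - Poly_Mapping.map ((*) (q i j)) (free_gen i * free_gen j) \<in> carrier F"
proof -
  have i: "free_gen i \<in> carrier F" "free_gen j \<in> carrier F"
    using assms by (auto intro: free_gen_closed)
  then have "free_gen j * free_gen i \<in> carrier F" "free_gen i * free_gen j \<in> carrier F"
    using F.m_closed[of "free_gen j" "free_gen i"] F.m_closed[of "free_gen i" "free_gen j"] by simp_all
  then show ?thesis
    using F.minus_closed minus_free_algebra scale_closed by metis
qed

lemma ideal_quantum_ideal: "ideal J F"
  unfolding quantum_ideal_def
  by (rule F.genideal_ideal) (use quantum_relation_closed in blast)

lemma k_algebra_quantum_poly_algebra: "k_algebra P"
  and epi_quantum_poly_algebra: "k_algebra_epi F P (\<lambda>p. J +>\<^bsub>F\<^esub> p)"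
  unfolding quantum_poly_algebra_def
  using F.quotient_algebra_epi[OF ideal_quantum_ideal] by blast+

interpretation P: k_algebra P
  by (rule k_algebra_quantum_poly_algebra)

lemma quantum_poly_gen_square:
  assumes "i \<in> {1..n}"
  shows "quantum_poly_gen n q i [^]\<^bsub>P\<^esub> (2::nat) = J +>\<^bsub>F\<^esub> (free_gen i * free_gen i)"
proof -
  have i: "free_gen i \<in> carrier F" by (rule free_gen_closed[OF assms])
  then have "quantum_poly_gen n q i \<in> carrier P"
    using epi_quantum_poly_algebra by (auto simp: k_algebra_epi_def quantum_poly_gen_def)
  then have "quantum_poly_gen n q i [^]\<^bsub>P\<^esub> (2::nat) =
      quantum_poly_gen n q i \<otimes>\<^bsub>P\<^esub> quantum_poly_gen n q i"
    by (simp add: numeral_2_eq_2)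
  also have "\<dots> = J +>\<^bsub>F\<^esub> (free_gen i * free_gen i)"
    using epi_quantum_poly_algebra i by (simp add: k_algebra_epi_def quantum_poly_gen_def)
  finally show ?thesis .
qed

lemma quantum_poly_square_closed:
  assumes "i \<in> {1..n}"
  shows "quantum_poly_gen n q i [^]\<^bsub>P\<^esub> (2::nat) \<in> carrier P"
proof -
  have "quantum_poly_gen n q i \<in> carrier P"
    using epi_quantum_poly_algebra free_gen_closed[OF assms]
    by (auto simp: k_algebra_epi_def quantum_poly_gen_def)
  then show ?thesis by simp
qed

lemma ideal_squares_ideal: "ideal (squares_ideal n q) P"
  unfolding squares_ideal_def
  by (rule P.genideal_ideal) (use quantum_poly_square_closed in auto)

lemma k_algebra_Aq: "k_algebra (Aq n q)"
  unfolding Aq_def by (rule P.quotient_algebra_epi(1)[OF ideal_squares_ideal])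

lemma epi_Aq_class: "k_algebra_epi F (Aq n q) \<pi>"
  unfolding Aq_def Aq_class_def
  by (rule k_algebra_epi_comp[OF k_algebra_free_algebra epi_quantum_poly_algebra
        P.quotient_algebra_epi(2)[OF ideal_squares_ideal]])

lemma Aq_class_gen: "Aq_gen n q i = \<pi> (free_gen i)"
  by (simp add: Aq_gen_def quantum_poly_gen_def Aq_class_def)

lemma word_coord_quantum_relation:
  assumes "i < j"
  shows "word_coord q
    (free_gen j * free_gen i - Poly_Mapping.map ((*) (q i j)) (free_gen i * free_gen j)) S = 0"
  using assms
  by (auto simp: word_coord_diff word_coord_scale free_gen_def mult_single plus_list_def
      word_coord_single reorder_def)

lemma word_coord_square: "word_coord q (free_gen i * free_gen i) S = 0"
  by (simp add: free_gen_def mult_single plus_list_def word_coord_single)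

text \<open>
  The defining relations have vanishing coordinates, so the ideals that they generate do not
  identify elements with different coordinates.
\<close>

lemma quantum_ideal_le: "J \<subseteq> coord_ideal n q"
  unfolding quantum_ideal_def
  by (rule F.genideal_minimal[OF ideal_coord_ideal])
    (auto simp: coord_ideal_def quantum_relation_closed word_coord_quantum_relation)

lemma squares_ideal_le: "squares_ideal n q \<subseteq> (\<lambda>p. J +>\<^bsub>F\<^esub> p) ` coord_ideal n q"
  unfolding squares_ideal_def
proof (rule P.genideal_minimal)
  show "ideal ((\<lambda>p. J +>\<^bsub>F\<^esub> p) ` coord_ideal n q) P"
    unfolding quantum_poly_algebra_def
    by (rule F.ideal_image_quotient_algebra[OF ideal_quantum_ideal ideal_coord_ideal])
  show "{quantum_poly_gen n q i [^]\<^bsub>P\<^esub> (2::nat) |i. 1 \<le> i \<and> i \<le> n} \<subseteq>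
      (\<lambda>p. J +>\<^bsub>F\<^esub> p) ` coord_ideal n q"
  proof
    fix a assume "a \<in> {quantum_poly_gen n q i [^]\<^bsub>P\<^esub> (2::nat) |i. 1 \<le> i \<and> i \<le> n}"
    then obtain i where i: "i \<in> {1..n}" and "a = quantum_poly_gen n q i [^]\<^bsub>P\<^esub> (2::nat)"
      by auto
    then have a: "a = J +>\<^bsub>F\<^esub> (free_gen i * free_gen i)" using quantum_poly_gen_square by simp
    have "free_gen i * free_gen i \<in> carrier F"
      using F.m_closed[OF free_gen_closed[OF i] free_gen_closed[OF i]] by simp
    then have "free_gen i * free_gen i \<in> coord_ideal n q"
      by (simp add: coord_ideal_def word_coord_square)
    then show "a \<in> (\<lambda>p. J +>\<^bsub>F\<^esub> p) ` coord_ideal n q" unfolding a by (rule imageI)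
  qed
qed

lemma word_coord_eq_of_Aq_class_eq:
  assumes p: "p \<in> carrier F" and r: "r \<in> carrier F" and eq: "\<pi> p = \<pi> r" and S: "S \<subseteq> {1..n}"
  shows "word_coord q p S = word_coord q r S"
proof -
  let ?h = "\<lambda>p. J +>\<^bsub>F\<^esub> p"
  note Q = F.quotient_eq_iff_same_a_r_cos[OF ideal_quantum_ideal]
  have hP: "?h x \<in> carrier P" if "x \<in> carrier F" for x
    using epi_quantum_poly_algebra that by (auto simp: k_algebra_epi_def)
  have pr: "p - r \<in> carrier F"
    using F.minus_closed[OF p r] by (simp add: minus_free_algebra[OF p r])
  have "?h (p - r) \<oplus>\<^bsub>P\<^esub> ?h r = ?h p"
    using k_algebra_epiD(4)[OF epi_quantum_poly_algebra pr r] by simp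
  then have "?h p \<ominus>\<^bsub>P\<^esub> ?h r = (?h (p - r) \<oplus>\<^bsub>P\<^esub> ?h r) \<ominus>\<^bsub>P\<^esub> ?h r" by metis
  also have "\<dots> = ?h (p - r)"
    using hP[OF pr] hP[OF r] by (simp add: P.minus_eq P.a_assoc P.r_neg)
  finally have diff: "?h p \<ominus>\<^bsub>P\<^esub> ?h r = ?h (p - r)" .
  have "?h p \<ominus>\<^bsub>P\<^esub> ?h r \<in> squares_ideal n q"
    using eq P.quotient_eq_iff_same_a_r_cos[OF ideal_squares_ideal hP[OF p] hP[OF r]]
    by (simp add: Aq_class_def)
  then obtain s where s: "s \<in> coord_ideal n q" and "?h (p - r) = ?h s"
    using squares_ideal_le diff by auto
  then have "p - r \<ominus>\<^bsub>F\<^esub> s \<in> J"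
    using Q[OF pr, of s] by (auto simp: coord_ideal_def)
  then have "p - r - s \<in> coord_ideal n q"
    using quantum_ideal_le s minus_free_algebra[OF pr, of s] by (auto simp: coord_ideal_def)
  then show ?thesis using s S by (simp add: coord_ideal_def word_coord_diff)
qed

lemmas Aq_class_closed = k_algebra_epiD(1)[OF epi_Aq_class]
lemmas Aq_class_surj = k_algebra_epiD(2)[OF epi_Aq_class]
lemmas Aq_class_one = k_algebra_epiD(3)[OF epi_Aq_class, simplified]
lemmas Aq_class_add = k_algebra_epiD(4)[OF epi_Aq_class, simplified]
lemmas Aq_class_mult = k_algebra_epiD(5)[OF epi_Aq_class, simplified]
lemmas Aq_class_smult = k_algebra_epiD(6)[OF epi_Aq_class, simplified]

text \<open>
  Equality of the classes in \<open>A(q)\<close>; the straightening below takes place in the free algebra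
  modulo this relation.
\<close>

abbreviation eqv :: "(nat list \<Rightarrow>\<^sub>0 'k) \<Rightarrow> (nat list \<Rightarrow>\<^sub>0 'k) \<Rightarrow> bool"  (infix "\<sim>" 50) where
  "p \<sim> r \<equiv> p \<in> carrier F \<and> r \<in> carrier F \<and> \<pi> p = \<pi> r"

lemma eqv_add: "p \<sim> p' \<Longrightarrow> r \<sim> r' \<Longrightarrow> p + r \<sim> p' + r'"
  using F.a_closed[of p r] F.a_closed[of p' r'] by (simp add: Aq_class_add)

lemma eqv_mult: "p \<sim> p' \<Longrightarrow> r \<sim> r' \<Longrightarrow> p * r \<sim> p' * r'"
  using F.m_closed[of p r] F.m_closed[of p' r'] by (simp add: Aq_class_mult)

lemma eqv_quantum_relation:
  assumes "1 \<le> i" "i < j" "j \<le> n"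
  shows "Poly_Mapping.single [j, i] 1 \<sim> Poly_Mapping.single [i, j] (q i j)"
proof -
  let ?x = "Poly_Mapping.single [j, i] (1::'k)" and ?y = "Poly_Mapping.single [i, j] (q i j)"
  have xy: "?x \<in> carrier F" "?y \<in> carrier F"
    using assms by (auto intro!: single_mem_free_algebra)
  have "?x - ?y = free_gen j * free_gen i - Poly_Mapping.map ((*) (q i j)) (free_gen i * free_gen j)"
    by (simp add: free_gen_def mult_single plus_list_def)
  then have "?x - ?y \<in> J"
    unfolding quantum_ideal_def using assms quantum_relation_closed
    by (intro subsetD[OF F.genideal_self]) auto
  then have "J +>\<^bsub>F\<^esub> ?x = J +>\<^bsub>F\<^esub> ?y"
    using F.quotient_eq_iff_same_a_r_cos[OF ideal_quantum_ideal xy] minus_free_algebra[OF xy] by simp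
  then show ?thesis using xy by (simp add: Aq_class_def)
qed

lemma eqv_square:
  assumes "i \<in> {1..n}"
  shows "Poly_Mapping.single [i, i] 1 \<sim> 0"
proof -
  let ?x = "Poly_Mapping.single [i, i] (1::'k)"
  have x: "?x \<in> carrier F" using assms by (auto intro!: single_mem_free_algebra)
  have zero: "(0 :: nat list \<Rightarrow>\<^sub>0 'k) \<in> carrier F" using F.zero_closed by simp
  have xP: "J +>\<^bsub>F\<^esub> ?x \<in> carrier P" and zP: "J +>\<^bsub>F\<^esub> 0 \<in> carrier P"
    using k_algebra_epiD(1)[OF epi_quantum_poly_algebra] x zero by blast+
  have "J +>\<^bsub>F\<^esub> ?x = quantum_poly_gen n q i [^]\<^bsub>P\<^esub> (2::nat)"
    using quantum_poly_gen_square[OF assms] by (simp add: free_gen_def mult_single plus_list_def)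
  also have "\<dots> \<in> squares_ideal n q"
    unfolding squares_ideal_def using assms quantum_poly_square_closed
    by (intro subsetD[OF P.genideal_self]) auto
  finally have x_mem: "J +>\<^bsub>F\<^esub> ?x \<in> squares_ideal n q" .
  have "(J +>\<^bsub>F\<^esub> 0) \<oplus>\<^bsub>P\<^esub> (J +>\<^bsub>F\<^esub> 0) = J +>\<^bsub>F\<^esub> 0"
    using k_algebra_epiD(4)[OF epi_quantum_poly_algebra zero zero] by simp
  then have "J +>\<^bsub>F\<^esub> 0 = \<zero>\<^bsub>P\<^esub>" using zP by (simp add: P.add.l_cancel_one)
  then have "(J +>\<^bsub>F\<^esub> ?x) \<ominus>\<^bsub>P\<^esub> (J +>\<^bsub>F\<^esub> 0) \<in> squares_ideal n q"
    using x_mem xP by (simp add: P.minus_eq)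
  then show ?thesis
    using P.quotient_eq_iff_same_a_r_cos[OF ideal_squares_ideal xP zP] x zero
    by (simp add: Aq_class_def)
qed

lemma single_append:
  "Poly_Mapping.single (u @ v) (a * b) = Poly_Mapping.single u a * Poly_Mapping.single v (b::'k)"
  by (simp add: mult_single plus_list_def)

lemma eqv_single_refl: "set w \<subseteq> {1..n} \<Longrightarrow> Poly_Mapping.single w c \<sim> Poly_Mapping.single w c"
  by (simp add: single_mem_free_algebra)

text \<open>
  Insertion of a letter into a sorted word: it is moved to the right past the smaller letters,
  and the word vanishes if the letter is met.
\<close>

lemma eqv_Cons_sorted:
  assumes "i \<in> {1..n}" "set w \<subseteq> {1..n}" "sorted_wrt (<) w"
  shows "Poly_Mapping.single (i # w) c \<sim>
    (if i \<in> set w then 0 else Poly_Mapping.single (insort i w) (c * reorder q {i} (set w)))"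
  using assms(2,3)
proof (induction w arbitrary: c)
  case Nil
  then show ?case using assms(1) eqv_single_refl[of "[i]"] by simp
next
  case (Cons j w)
  then have j: "j \<in> {1..n}" and w: "set w \<subseteq> {1..n}" and jw: "\<And>k. k \<in> set w \<Longrightarrow> j < k" by auto
  consider "i < j" | "i = j" | "j < i" by linarith
  then show ?case
  proof cases
    case 1
    then have "i \<notin> set (j # w)" "insort i (j # w) = i # j # w" using jw by fastforce+
    moreover have "reorder q {i} (set (j # w)) = 1"
      using 1 jw by (intro reorder_eq_1) fastforce
    ultimately show ?thesis
      using eqv_single_refl[of "i # j # w" c] assms(1) j w by simp
  next
    case 2
    have "Poly_Mapping.single (i # j # w) c = Poly_Mapping.single [i, i] 1 * Poly_Mapping.single w c"
      using single_append[of "[i, i]" w 1 c] 2 by simp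
    moreover have "Poly_Mapping.single [i, i] 1 * Poly_Mapping.single w c \<sim> 0 * Poly_Mapping.single w c"
      by (intro eqv_mult eqv_square eqv_single_refl assms(1) w)
    ultimately show ?thesis using 2 by simp
  next
    case 3
    let ?r = "if i \<in> set w then 0 else Poly_Mapping.single (insort i w) (c * reorder q {i} (set w))"
    have "Poly_Mapping.single (i # j # w) c = Poly_Mapping.single [i, j] 1 * Poly_Mapping.single w c"
      using single_append[of "[i, j]" w 1 c] by simp
    also have "\<dots> \<sim> Poly_Mapping.single [j, i] (q j i) * Poly_Mapping.single w c"
      using j 3 assms(1) by (intro eqv_mult eqv_quantum_relation eqv_single_refl w) auto
    finally have 1: "Poly_Mapping.single (i # j # w) c \<sim>
        Poly_Mapping.single [j, i] (q j i) * Poly_Mapping.single w c" .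
    have "Poly_Mapping.single [j, i] (q j i) * Poly_Mapping.single w c =
        Poly_Mapping.single [j] (q j i) * Poly_Mapping.single (i # w) c"
      by (simp add: mult_single plus_list_def)
    also have "\<dots> \<sim> Poly_Mapping.single [j] (q j i) * ?r"
      using j w Cons.prems by (intro eqv_mult eqv_single_refl Cons.IH) auto
    finally have 2: "Poly_Mapping.single [j, i] (q j i) * Poly_Mapping.single w c \<sim>
        Poly_Mapping.single [j] (q j i) * ?r" .
    have "j \<notin> set w" using jw by blast
    then have "reorder q {i} (set (j # w)) = q j i * reorder q {i} (set w)"
      using 3 by (simp add: reorder_def)
    then have 4: "Poly_Mapping.single [j] (q j i) * ?r =
      (if i \<in> set (j # w) then 0
       else Poly_Mapping.single (insort i (j # w)) (c * reorder q {i} (set (j # w))))"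
      using 3 by (simp add: mult_single plus_list_def mult_ac)
    show ?thesis using 1 2 unfolding 4[symmetric] by simp
  qed
qed

lemma eqv_sorted:
  assumes "set w \<subseteq> {1..n}"
  shows "Poly_Mapping.single w c \<sim>
    (if distinct w then Poly_Mapping.single (sorted_list_of_set (set w)) (c * sort_factor q w) else 0)"
  using assms
proof (induction w arbitrary: c)
  case Nil
  then show ?case using eqv_single_refl[of "[]"] by simp
next
  case (Cons i w)
  then have i: "i \<in> {1..n}" and w: "set w \<subseteq> {1..n}" by auto
  let ?s = "sorted_list_of_set (set w)"
  let ?r = "if distinct w then Poly_Mapping.single ?s (c * sort_factor q w) else 0"
  have "Poly_Mapping.single (i # w) c = Poly_Mapping.single [i] 1 * Poly_Mapping.single w c"
    using single_append[of "[i]" w 1 c] by simp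
  also have "\<dots> \<sim> Poly_Mapping.single [i] 1 * ?r"
    using i by (intro eqv_mult eqv_single_refl Cons.IH w) auto
  finally have 1: "Poly_Mapping.single (i # w) c \<sim> Poly_Mapping.single [i] 1 * ?r" .
  show ?case
  proof (cases "distinct w")
    case True
    have "Poly_Mapping.single [i] 1 * ?r = Poly_Mapping.single (i # ?s) (c * sort_factor q w)"
      using True by (simp add: mult_single plus_list_def)
    also have "\<dots> \<sim> (if i \<in> set ?s then 0
        else Poly_Mapping.single (insort i ?s) (c * sort_factor q w * reorder q {i} (set ?s)))"
      using w by (intro eqv_Cons_sorted i) auto
    also have "(if i \<in> set ?s then 0
        else Poly_Mapping.single (insort i ?s) (c * sort_factor q w * reorder q {i} (set ?s))) =
      (if distinct (i # w) then Poly_Mapping.single (sorted_list_of_set (set (i # w)))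
        (c * sort_factor q (i # w)) else 0)"
      using True by (simp add: sorted_list_of_set.sorted_key_list_of_set_insert mult_ac)
    finally show ?thesis using 1 by simp
  qed (use 1 in simp)
qed

lemma eqv_normal_form:
  assumes "p \<in> carrier F"
  shows "p \<sim> normal_form n q p"
proof -
  have zero: "0 \<in> carrier F" using F.zero_closed by simp
  have "Poly_Mapping.keys p \<subseteq> {w. set w \<subseteq> {1..n}}"
    using assms by (auto simp: free_algebra_def)
  then show ?thesis
  proof (induction rule: poly_mapping_keys_induct)
    case zero
    show ?case using \<open>0 \<in> carrier F\<close> by (simp add: normal_form_def)
  next
    case (single w c)
    then have w: "set w \<subseteq> {1..n}" by simp
    let ?s = "if distinct w
      then Poly_Mapping.single (sorted_list_of_set (set w)) (c * sort_factor q w) else 0"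
    have "normal_form n q (Poly_Mapping.single w c) =
        (\<Sum>S\<in>Pow {1..n}. if set w = S then ?s else 0)"
      unfolding normal_form_def by (intro sum.cong) (auto simp: word_coord_single)
    also have "\<dots> = ?s" using w by simp
    finally show ?case using eqv_sorted[OF w, of c] by simp
  next
    case (add p r)
    have "normal_form n q (p + r) = normal_form n q p + normal_form n q r"
      by (simp add: normal_form_def word_coord_add single_add sum.distrib)
    then show ?case using eqv_add[OF add.IH] by simp
  qed
qed

end

section \<open>The coordinates of the quotient\<close>

text \<open>
  The coordinates on \<open>A(q)\<close>, computed with an arbitrary representative in the free algebra.
\<close>

definition Aq_coord ::
    "nat \<Rightarrow> (nat \<Rightarrow> nat \<Rightarrow> 'k::field) \<Rightarrow> (nat list \<Rightarrow>\<^sub>0 'k) set set \<Rightarrow> nat set \<Rightarrow> 'k" where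
  "Aq_coord n q a S = word_coord q (SOME p. p \<in> carrier (free_algebra n) \<and> Aq_class n q p = a) S"

lemma Aq_coord_class:
  assumes p: "p \<in> carrier (free_algebra n)" and S: "S \<subseteq> {1..n}"
  shows "Aq_coord n q (Aq_class n q p) S = word_coord q p S"
proof -
  let ?r = "SOME r. r \<in> carrier (free_algebra n) \<and> Aq_class n q r = Aq_class n q p"
  have "?r \<in> carrier (free_algebra n) \<and> Aq_class n q ?r = Aq_class n q p"
    by (rule someI[of _ p]) (use p in simp)
  then show ?thesis
    using word_coord_eq_of_Aq_class_eq[of ?r n p q S] p S by (simp add: Aq_coord_def)
qed

lemma quantum_exterior_Aq:
  fixes q :: "nat \<Rightarrow> nat \<Rightarrow> 'k::field"
  assumes q: "\<And>i j. 1 \<le> i \<Longrightarrow> i < j \<Longrightarrow> j \<le> n \<Longrightarrow> q i j \<noteq> 0"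
  shows "quantum_exterior (Aq n q) {1..n} q (Aq_coord n q)"
proof -
  interpret F: k_algebra "free_algebra n :: ('k, nat list \<Rightarrow>\<^sub>0 'k) module"
    by (rule k_algebra_free_algebra)
  let ?F = "free_algebra n :: ('k, nat list \<Rightarrow>\<^sub>0 'k) module"
  note coord = Aq_coord_class
  have rep: "\<exists>p\<in>carrier ?F. a = Aq_class n q p" if "a \<in> carrier (Aq n q)" for a
    using that Aq_class_surj[of n q] by auto
  show ?thesis
  proof (rule quantum_exterior.intro[OF k_algebra_Aq], unfold_locales)
    fix a b S assume "a \<in> carrier (Aq n q)" "b \<in> carrier (Aq n q)" and S: "S \<subseteq> {1..n}"
    then obtain p r where p: "p \<in> carrier ?F" "a = Aq_class n q p"
      and r: "r \<in> carrier ?F" "b = Aq_class n q r"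
      using rep by metis
    have closed: "p + r \<in> carrier ?F" "p * r \<in> carrier ?F"
      using F.a_closed[OF p(1) r(1)] F.m_closed[OF p(1) r(1)] by simp_all
    show "Aq_coord n q (a \<oplus>\<^bsub>Aq n q\<^esub> b) S = Aq_coord n q a S + Aq_coord n q b S"
      unfolding p(2) r(2) Aq_class_add[OF p(1) r(1), symmetric]
      by (simp only: coord[OF p(1) S] coord[OF r(1) S] coord[OF closed(1) S] word_coord_add)
    have fin: "finite S" using S finite_subset by blast
    have "Aq_coord n q (a \<otimes>\<^bsub>Aq n q\<^esub> b) S = word_coord q (p * r) S"
      unfolding p(2) r(2) Aq_class_mult[OF p(1) r(1), symmetric]
      by (rule coord[OF closed(2) S])
    also have "\<dots> = (\<Sum>T\<in>Pow S. reorder q T (S - T) * word_coord q p T * word_coord q r (S - T))"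
      by (rule word_coord_mult[OF fin])
    also have "\<dots> = (\<Sum>T\<in>Pow S. reorder q T (S - T) * Aq_coord n q a T * Aq_coord n q b (S - T))"
    proof (intro sum.cong refl)
      fix T assume "T \<in> Pow S"
      then have "T \<subseteq> {1..n}" "S - T \<subseteq> {1..n}" using S by auto
      then show "reorder q T (S - T) * word_coord q p T * word_coord q r (S - T) =
          reorder q T (S - T) * Aq_coord n q a T * Aq_coord n q b (S - T)"
        by (simp only: p(2) r(2) coord[OF p(1)] coord[OF r(1)])
    qed
    finally show "Aq_coord n q (a \<otimes>\<^bsub>Aq n q\<^esub> b) S =
      (\<Sum>T\<in>Pow S. reorder q T (S - T) * Aq_coord n q a T * Aq_coord n q b (S - T))" .
  next
    fix a S c assume "a \<in> carrier (Aq n q)" and S: "S \<subseteq> {1..n}"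
    then obtain p where p: "p \<in> carrier ?F" "a = Aq_class n q p" using rep by blast
    have closed: "Poly_Mapping.map ((*) c) p \<in> carrier ?F"
      using F.smult_closed[OF p(1)] by simp
    show "Aq_coord n q (c \<odot>\<^bsub>Aq n q\<^esub> a) S = c * Aq_coord n q a S"
      unfolding p(2) Aq_class_smult[OF p(1), symmetric]
      by (simp only: coord[OF p(1) S] coord[OF closed S] word_coord_scale)
  next
    fix a b assume "a \<in> carrier (Aq n q)" "b \<in> carrier (Aq n q)"
      and eq: "\<And>S. S \<subseteq> {1..n} \<Longrightarrow> Aq_coord n q a S = Aq_coord n q b S"
    then obtain p r where p: "p \<in> carrier ?F" "a = Aq_class n q p"
      and r: "r \<in> carrier ?F" "b = Aq_class n q r"
      using rep by metis
    \<comment> \<open>Elements with equal coordinates have the same normal form.\<close>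
    have "normal_form n q p = normal_form n q r"
      unfolding normal_form_def
    proof (intro sum.cong refl)
      fix S assume "S \<in> Pow {1..n}"
      then have S: "S \<subseteq> {1..n}" by simp
      show "Poly_Mapping.single (sorted_list_of_set S) (word_coord q p S) =
          Poly_Mapping.single (sorted_list_of_set S) (word_coord q r S)"
        using eq[OF S] by (simp only: p(2) r(2) coord[OF p(1) S] coord[OF r(1) S])
    qed
    then show "a = b"
      using eqv_normal_form[OF p(1), of q] eqv_normal_form[OF r(1), of q] by (simp add: p(2) r(2))
  next
    fix f :: "nat set \<Rightarrow> 'k"
    let ?p = "\<Sum>S\<in>Pow {1..n}. Poly_Mapping.single (sorted_list_of_set S) (f S)"
    have "?p \<in> carrier ?F"
    proof -
      have "set w \<subseteq> {1..n}" if w: "w \<in> Poly_Mapping.keys ?p" for w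
      proof -
        obtain S where S: "S \<subseteq> {1..n}"
          and "w \<in> Poly_Mapping.keys (Poly_Mapping.single (sorted_list_of_set S) (f S))"
          using w Poly_Mapping.keys_sum[of "\<lambda>S. Poly_Mapping.single (sorted_list_of_set S) (f S)"
              "Pow {1..n}"] by blast
        then have "w = sorted_list_of_set S" by (simp split: if_splits)
        moreover have "finite S" using S finite_subset by blast
        ultimately show ?thesis using S by simp
      qed
      then show ?thesis by (simp add: free_algebra_def)
    qed
    moreover have "Aq_coord n q (Aq_class n q ?p) S = f S" if S: "S \<subseteq> {1..n}" for S
    proof -
      have "Aq_coord n q (Aq_class n q ?p) S = word_coord q ?p S"
        by (rule coord[OF \<open>?p \<in> carrier ?F\<close> S])
      also have "\<dots> = (\<Sum>T\<in>Pow {1..n}. word_coord q (Poly_Mapping.single (sorted_list_of_set T) (f T)) S)"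
        by (rule word_coord_sum)
      also have "\<dots> = (\<Sum>T\<in>Pow {1..n}. if S = T then f T else 0)"
      proof (intro sum.cong refl)
        fix T :: "nat set" assume "T \<in> Pow {1..n}"
        then have "finite T" using finite_subset by blast
        then show "word_coord q (Poly_Mapping.single (sorted_list_of_set T) (f T)) S =
            (if S = T then f T else 0)"
          by (auto simp: word_coord_single sort_factor_sorted)
      qed
      also have "\<dots> = f S" using S by simp
      finally show ?thesis .
    qed
    ultimately show "\<exists>a\<in>carrier (Aq n q). \<forall>S\<subseteq>{1..n}. Aq_coord n q a S = f S"
      using Aq_class_closed[of ?p n q] by blast
  next
    fix S assume S: "S \<subseteq> {1..n}"
    have "1 \<in> carrier ?F" using F.one_closed by simp
    then show "Aq_coord n q \<one>\<^bsub>Aq n q\<^esub> S = (if S = {} then 1 else 0)"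
      unfolding Aq_class_one[symmetric] by (simp only: coord[OF _ S] word_coord_one)
  qed (use q in auto)
qed

lemma Aq_monomial_class:
  fixes q :: "nat \<Rightarrow> nat \<Rightarrow> 'k::field"
  assumes \<epsilon>: "\<And>i. i \<in> {1..n} \<Longrightarrow> \<epsilon> i \<in> {0, 1}"
  shows "Aq_monomial n q \<epsilon> = Aq_class n q (Poly_Mapping.single (filter (\<lambda>i. \<epsilon> i = 1) [1..<Suc n]) 1)"
proof -
  interpret A: k_algebra "Aq n q" by (rule k_algebra_Aq)
  have "foldr (\<lambda>i y. (Aq_gen n q i [^]\<^bsub>Aq n q\<^esub> \<epsilon> i) \<otimes>\<^bsub>Aq n q\<^esub> y) w \<one>\<^bsub>Aq n q\<^esub> =
      Aq_class n q (Poly_Mapping.single (filter (\<lambda>i. \<epsilon> i = 1) w) 1)" if "set w \<subseteq> {1..n}" for w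
    using that
  proof (induction w)
    case Nil
    then show ?case by (simp add: Aq_class_one[symmetric] zero_list_def flip: single_one)
  next
    case (Cons i w)
    let ?v = "filter (\<lambda>i. \<epsilon> i = 1) w"
    have i: "i \<in> {1..n}" and v: "set ?v \<subseteq> {1..n}" using Cons.prems by auto
    have closed: "Poly_Mapping.single ?v (1::'k) \<in> carrier (free_algebra n)"
      by (rule single_mem_free_algebra[OF v])
    have gen: "Aq_gen n q i \<in> carrier (Aq n q)"
      unfolding Aq_class_gen by (rule Aq_class_closed[OF free_gen_closed[OF i]])
    consider "\<epsilon> i = 0" | "\<epsilon> i = 1" using \<epsilon>[OF i] by auto
    then show ?case
    proof cases
      case 1
      then show ?thesis
        using Cons Aq_class_closed[OF closed, of q] by (simp del: One_nat_def)
    next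
      case 2
      then have "(Aq_gen n q i [^]\<^bsub>Aq n q\<^esub> \<epsilon> i) \<otimes>\<^bsub>Aq n q\<^esub> Aq_class n q (Poly_Mapping.single ?v 1) =
          Aq_class n q (free_gen i * Poly_Mapping.single ?v 1)"
        using gen Aq_class_mult[OF free_gen_closed[OF i] closed] by (simp add: Aq_class_gen)
      then show ?thesis using Cons 2 by (simp add: free_gen_def mult_single plus_list_def)
    qed
  qed
  then show ?thesis unfolding Aq_monomial_def by (rule meta_mp) auto
qed

section \<open>The two gradings of the quotient\<close>

context
  fixes n :: nat and q :: "nat \<Rightarrow> nat \<Rightarrow> 'k::field"
  assumes q: "\<And>i j. 1 \<le> i \<Longrightarrow> i < j \<Longrightarrow> j \<le> n \<Longrightarrow> q i j \<noteq> 0"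
begin

interpretation quantum_exterior "Aq n q" "{1..n}" q "Aq_coord n q"
  by (rule quantum_exterior_Aq[OF q])

lemma Aq_monomial_eq_mon:
  assumes "\<And>i. i \<in> {1..n} \<Longrightarrow> \<epsilon> i \<in> {0, 1}"
  shows "Aq_monomial n q \<epsilon> = mon {i \<in> {1..n}. \<epsilon> i = 1}"
proof -
  let ?w = "filter (\<lambda>i. \<epsilon> i = 1) [1..<Suc n]"
  have set_w: "set ?w = {i \<in> {1..n}. \<epsilon> i = 1}" by auto
  have w: "Poly_Mapping.single ?w (1::'k) \<in> carrier (free_algebra n)"
    by (rule single_mem_free_algebra) auto
  have monomial: "Aq_monomial n q \<epsilon> = Aq_class n q (Poly_Mapping.single ?w 1)"
    by (rule Aq_monomial_class) (rule assms)
  show ?thesis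
    unfolding monomial
  proof (rule coord_inj[OF Aq_class_closed[OF w] mon_closed])
    fix S :: "nat set" assume S: "S \<subseteq> {1..n}"
    have "sort_factor q ?w = 1" by (intro sort_factor_sorted sorted_wrt_filter sorted_upt)
    then have "Aq_coord n q (Aq_class n q (Poly_Mapping.single ?w 1)) S = (if set ?w = S then 1 else 0)"
      unfolding Aq_coord_class[OF w S] word_coord_single by simp
    then show "Aq_coord n q (Aq_class n q (Poly_Mapping.single ?w 1)) S =
        Aq_coord n q (mon {i \<in> {1..n}. \<epsilon> i = 1}) S"
      unfolding set_w using coord_mon[OF S] by auto
  qed
qed

lemma graded_Aq_Z:
  "graded_quantum_exterior (Aq n q) {1..n} q (Aq_coord n q) integer_group
     (\<lambda>S. int (card S)) (Aq_Z_component n q)"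
proof (intro graded_quantum_exterior.intro graded_quantum_exterior_axioms.intro group_integer_group
    quantum_exterior_axioms)
  fix d
  have "{Aq_monomial n q \<epsilon> |\<epsilon>. \<epsilon> \<in> {1..n} \<rightarrow> {0, 1} \<and> int (\<Sum>i=1..n. \<epsilon> i) = d} =
      {mon S |S. S \<subseteq> {1..n} \<and> int (card S) = d}" (is "?L = ?R")
  proof (intro equalityI subsetI)
    fix a assume "a \<in> ?L"
    then obtain \<epsilon> where \<epsilon>: "\<epsilon> \<in> {1..n} \<rightarrow> {0, 1}" "int (\<Sum>i=1..n. \<epsilon> i) = d"
      and a: "a = Aq_monomial n q \<epsilon>"
      by blast
    have "(\<Sum>i=1..n. \<epsilon> i) = (\<Sum>i=1..n. if \<epsilon> i = 1 then 1 else 0)"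
      using \<epsilon>(1) by (intro sum.cong refl) auto
    also have "\<dots> = card {i \<in> {1..n}. \<epsilon> i = 1}"
      by (simp add: sum.If_cases Int_def)
    finally have "int (card {i \<in> {1..n}. \<epsilon> i = 1}) = d" using \<epsilon>(2) by simp
    moreover have "a = mon {i \<in> {1..n}. \<epsilon> i = 1}"
      unfolding a using \<epsilon>(1) by (intro Aq_monomial_eq_mon) auto
    ultimately show "a \<in> ?R" by (intro CollectI exI[of _ "{i \<in> {1..n}. \<epsilon> i = 1}"]) auto
  next
    fix a assume "a \<in> ?R"
    then obtain S where S: "S \<subseteq> {1..n}" "int (card S) = d" and a: "a = mon S" by blast
    let ?\<epsilon> = "\<lambda>i. if i \<in> S then 1 else 0 :: nat"
    have "{i \<in> {1..n}. ?\<epsilon> i = 1} = S" using S(1) by auto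
    then have "a = Aq_monomial n q ?\<epsilon>"
      using Aq_monomial_eq_mon[of ?\<epsilon>] a by simp
    moreover have "(\<Sum>i=1..n. ?\<epsilon> i) = card S"
      using S(1) by (simp add: sum.If_cases Int_absorb1)
    ultimately show "a \<in> ?L" using S(2) by (intro CollectI exI[of _ ?\<epsilon>]) auto
  qed
  then show "Aq_Z_component n q d = k_span (Aq n q) {mon S |S. S \<subseteq> {1..n} \<and> int (card S) = d}"
    by (simp add: Aq_Z_component_def)
next
  fix S T assume "S \<subseteq> {1..n}" "T \<subseteq> {1..n}" "S \<inter> T = {}"
  moreover from this have "finite S" "finite T" using finite_subset by blast+
  ultimately show "int (card (S \<union> T)) = int (card S) \<otimes>\<^bsub>integer_group\<^esub> int (card T)"
    by (simp add: card_Un_disjoint)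
qed auto

lemma graded_Aq_Z2:
  "graded_quantum_exterior (Aq n q) {1..n} q (Aq_coord n q) (Z2_power n)
     (\<lambda>S. \<lambda>i\<in>{1..n}. if i \<in> S then 1 else 0) (Aq_Z2_component n q)"
proof (intro graded_quantum_exterior.intro graded_quantum_exterior_axioms.intro quantum_exterior_axioms)
  show "group (Z2_power n)" by simp
next
  fix \<delta> assume "\<delta> \<in> carrier (Z2_power n)"
  then have \<delta>: "\<delta> \<in> (\<Pi>\<^sub>E i\<in>{1..n}. {0, 1})"
    by (auto simp: carrier_integer_mod_group PiE_iff)
  define S where "S = {i \<in> {1..n}. \<delta> i = 1}"
  have S: "S \<subseteq> {1..n}" by (auto simp: S_def)
  have "{i \<in> {1..n}. (nat \<circ> \<delta>) i = 1} = S" by (auto simp: S_def)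
  then have mon: "Aq_monomial n q (nat \<circ> \<delta>) = mon S"
    using Aq_monomial_eq_mon[of "nat \<circ> \<delta>"] PiE_mem[OF \<delta>] by fastforce
  define deg where "deg T = (\<lambda>i\<in>{1..n}. if i \<in> T then 1 else 0 :: int)" for T
  have "T = S" if "T \<subseteq> {1..n}" "deg T = \<delta>" for T
    unfolding S_def that(2)[symmetric] deg_def using that(1) by auto
  moreover have "deg S = \<delta>"
    using \<delta> by (auto simp: deg_def S_def fun_eq_iff PiE_iff extensional_def)
  ultimately have eq: "{mon T |T. T \<subseteq> {1..n} \<and> deg T = \<delta>} = {mon S}"
    using S by blast
  show "Aq_Z2_component n q \<delta> =
      k_span (Aq n q) {mon T |T. T \<subseteq> {1..n} \<and> (\<lambda>i\<in>{1..n}. if i \<in> T then 1 else 0) = \<delta>}"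
    unfolding eq[unfolded deg_def] Aq_Z2_component_def mon k_span_mon_singleton[OF S] ..
next
  fix S T :: "nat set" assume "S \<inter> T = {}"
  then show "(\<lambda>i\<in>{1..n}. if i \<in> S \<union> T then 1 else 0) =
      (\<lambda>i\<in>{1..n}. if i \<in> S then 1 else 0) \<otimes>\<^bsub>Z2_power n\<^esub> (\<lambda>i\<in>{1..n}. if i \<in> T then 1 else 0)"
    by (auto simp: fun_eq_iff)
qed (auto simp: fun_eq_iff)

end

theorem propositionC:
  fixes n :: nat and q :: "nat \<Rightarrow> nat \<Rightarrow> 'k::field"
  assumes "n \<ge> 2"
    and "\<And>i j. 1 \<le> i \<Longrightarrow> i < j \<Longrightarrow> j \<le> n \<Longrightarrow> q i j \<noteq> 0"
  shows
    "(frobenius_algebra (Aq n q) \<and>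
      (symmetric_algebra (Aq n q) \<longleftrightarrow>
        (\<forall>i\<in>{1..n-1}. q i n = (\<Prod>p\<in>{1..<i}. q p i) * (\<Prod>p\<in>{i<..n-1}. inverse (q i p))))) \<and>
     (graded_frobenius (Z2_power n) (Aq n q) (Aq_Z2_component n q) (Z2_ones n) \<and>
      (\<forall>\<sigma>\<in>carrier (Z2_power n). \<sigma> \<noteq> Z2_ones n \<longrightarrow>
        \<not> graded_frobenius (Z2_power n) (Aq n q) (Aq_Z2_component n q) \<sigma>)) \<and>
     (graded_frobenius integer_group (Aq n q) (Aq_Z_component n q) (int n) \<and>
      (\<forall>j::int. j \<noteq> int n \<longrightarrow>
        \<not> graded_frobenius integer_group (Aq n q) (Aq_Z_component n q) j))"
proof -
  interpret A: quantum_exterior "Aq n q" "{1..n}" q "Aq_coord n q"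
    by (rule quantum_exterior_Aq) (rule assms(2))
  interpret Z: graded_quantum_exterior "Aq n q" "{1..n}" q "Aq_coord n q" integer_group
    "\<lambda>S. int (card S)" "Aq_Z_component n q"
    by (rule graded_Aq_Z) (rule assms(2))
  interpret Z2: graded_quantum_exterior "Aq n q" "{1..n}" q "Aq_coord n q" "Z2_power n"
    "\<lambda>S. \<lambda>i\<in>{1..n}. if i \<in> S then 1 else 0" "Aq_Z2_component n q"
    by (rule graded_Aq_Z2) (rule assms(2))
  have "symmetric_algebra (Aq n q) \<longleftrightarrow>
      (\<forall>i\<in>{1..n}. reorder q {i} {1..n} = reorder q {1..n} {i})"
    using A.symmetric_if A.symmetric_only_if by blast
  also have "\<dots> \<longleftrightarrow>
      (\<forall>i\<in>{1..n-1}. q i n = (\<Prod>p\<in>{1..<i}. q p i) * (\<Prod>p\<in>{i<..n-1}. inverse (q i p)))"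
    by (rule reorder_commute_iff) (use assms in auto)
  finally have symmetric: "symmetric_algebra (Aq n q) \<longleftrightarrow>
      (\<forall>i\<in>{1..n-1}. q i n = (\<Prod>p\<in>{1..<i}. q p i) * (\<Prod>p\<in>{i<..n-1}. inverse (q i p)))" .
  have ones: "(\<lambda>i\<in>{1..n}. if i \<in> {1..n} then 1 else 0) = Z2_ones n"
    by (auto simp: fun_eq_iff)
  have card: "int (card {1..n}) = int n" by simp
  note Z2_top = Z2.graded_frobenius_top[unfolded ones]
    and Z2_unique = Z2.graded_frobenius_unique[unfolded ones]
    and Z_top = Z.graded_frobenius_top[unfolded card]
    and Z_unique = Z.graded_frobenius_unique[unfolded card]
  show ?thesis
  proof (intro conjI ballI allI impI)
    show "frobenius_algebra (Aq n q)" by (rule A.frobenius)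
    show "symmetric_algebra (Aq n q) \<longleftrightarrow>
      (\<forall>i\<in>{1..n-1}. q i n = (\<Prod>p\<in>{1..<i}. q p i) * (\<Prod>p\<in>{i<..n-1}. inverse (q i p)))"
      by (rule symmetric)
    show "graded_frobenius (Z2_power n) (Aq n q) (Aq_Z2_component n q) (Z2_ones n)"
      by (rule Z2_top)
    show "\<not> graded_frobenius (Z2_power n) (Aq n q) (Aq_Z2_component n q) \<sigma>"
      if "\<sigma> \<in> carrier (Z2_power n)" "\<sigma> \<noteq> Z2_ones n" for \<sigma>
      using Z2_unique[OF that(1)] that(2) by blast
    show "graded_frobenius integer_group (Aq n q) (Aq_Z_component n q) (int n)"
      by (rule Z_top)
    show "\<not> graded_frobenius integer_group (Aq n q) (Aq_Z_component n q) j" if "j \<noteq> int n" for j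
      using Z_unique[of j] that by auto
  qed
qed

end
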